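(* Let $Y$ be a complex Banach space of dimension at least two, $(\Omega,\Sigma,\mu)$ any measure space with $\dim L_\infty(\mu)\ge 2$, and $m\in\mathbb N$, $m\ge 2$. The following are equivalent (all spaces being complex): (i) the pair $(\ell_\infty^m,Y)$ has the BPBp-RSE; (ii) the pair $(c_0,Y)$ has the BPBp-RSE; (iii) the pair $(\ell_\infty,Y)$ has the BPBp-RSE; (iv) the pair $(L_\infty(\mu),Y)$ has the BPBp-RSE; (v) $Y$ is $\mathbb C$-uniformly convex.
   Context: All Banach spaces here are complex; $B_X$, $S_X$ are the closed unit ball and unit sphere of $X$; $\mathbb T=\{\lambda\in\mathbb C:|\lambda|=1\}$; $\mathcal L(X,Y)$ is the space of bounded linear operators. An operator $T\in\mathcal L(X,Y)$ is range strongly exposing, $T\in\mathrm{RSE}(X,Y)$, if there is $x_0\in S_X$ such that whenever $(x_n)\subseteq B_X$ satisfies $\|Tx_n\|\to\|T\|$, there are a subsequence $(x_{\sigma(n)})$ and $\lambda\in\mathbb T$ with $Tx_{\sigma(n)}\to\lambda Tx_0$. The pair $(X,Y)$ has the BPBp-RSE if for every $\varepsilon>0$ there is $0<\eta(\varepsilon)<\varepsilon$ such that for every $T\in\mathcal L(X,Y)$ with $\|T\|=1$ and every $x\in S_X$ with $\|Tx\|>1-\eta(\varepsilon)$, there exist $S\in\mathrm{RSE}(X,Y)$ and $x_0\in S_X$ with $\|S\|=\|Sx_0\|=1$, $\|S-T\|<\varepsilon$ and $\|x-x_0\|<\varepsilon$. A complex Banach space $Y$ is $\mathbb C$-uniformly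 convex if for every $\varepsilon>0$ there is $\delta>0$ such that whenever $y_0,y_1\in Y$ satisfy $\|y_0+wy_1\|\le 1$ for every $w\in\mathbb T$ and $\|y_1\|>\varepsilon$, one has $\|y_0\|<1-\delta$. *)

theory Defs
  imports "HOL-Analysis.Analysis" "HOL-Probability.Essential_Supremum"
begin

section \<open>Complex Banach spaces as a type class\<close>

text \<open>
  The real structure is the one inherited from the complex one, so every complex Banach space
  gives rise to an instance.
\<close>

class complex_banach = banach +
  fixes scaleC :: "complex \<Rightarrow> 'a \<Rightarrow> 'a" (infixr "*\<^sub>C" 75)
  assumes scaleC_add_right: "a *\<^sub>C (x + y) = a *\<^sub>C x + a *\<^sub>C y"
    and scaleC_add_left: "(a + b) *\<^sub>C x = a *\<^sub>C x + b *\<^sub>C x"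
    and scaleC_scaleC: "a *\<^sub>C b *\<^sub>C x = (a * b) *\<^sub>C x"
    and scaleC_one: "1 *\<^sub>C x = x"
    and scaleC_of_real: "complex_of_real r *\<^sub>C x = r *\<^sub>R x"
    and norm_scaleC: "norm (a *\<^sub>C x) = cmod a * norm x"

global_interpretation complex_vector: vector_space "scaleC :: complex \<Rightarrow> 'a \<Rightarrow> 'a::complex_banach"
  by unfold_locales
    (simp_all add: scaleC_add_right scaleC_add_left scaleC_scaleC scaleC_one)


section \<open>Complex normed spaces with an explicit carrier\<close>

text \<open>
  The domain spaces depend on terms (a natural number, a measure), hence cannot be types.
  They are given by a carrier together with operations that are only meaningful on it.
\<close>

record 'a cnspace =
  vecs :: "'a set"
  vzero :: 'a
  vadd :: "'a \<Rightarrow> 'a \<Rightarrow> 'a"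
  vscale :: "complex \<Rightarrow> 'a \<Rightarrow> 'a"
  vnorm :: "'a \<Rightarrow> real"

definition vdiff :: "'a cnspace \<Rightarrow> 'a \<Rightarrow> 'a \<Rightarrow> 'a" where
  "vdiff X x y = vadd X x (vscale X (- 1) y)"

definition unit_ball :: "'a cnspace \<Rightarrow> 'a set" where
  "unit_ball X = {x \<in> vecs X. vnorm X x \<le> 1}"

definition unit_sphere :: "'a cnspace \<Rightarrow> 'a set" where
  "unit_sphere X = {x \<in> vecs X. vnorm X x = 1}"

text \<open>Complex dimension at least two: there are two linearly independent vectors.\<close>

definition dim_ge_two :: "'a cnspace \<Rightarrow> bool" where
  "dim_ge_two X \<longleftrightarrow> (\<exists>u\<in>vecs X. \<exists>v\<in>vecs X. \<forall>a b.
     vadd X (vscale X a u) (vscale X b v) = vzero X \<longrightarrow> a = 0 \<and> b = 0)"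


section \<open>The spaces of bounded sequences\<close>

definition sup_seq_space :: "(nat \<Rightarrow> complex) set \<Rightarrow> (nat \<Rightarrow> complex) cnspace" where
  "sup_seq_space V = \<lparr> vecs = V, vzero = (\<lambda>_. 0), vadd = (\<lambda>x y i. x i + y i),
     vscale = (\<lambda>a x i. a * x i), vnorm = (\<lambda>x. SUP i. cmod (x i)) \<rparr>"

text \<open>An \<open>m\<close>-tuple is encoded as the sequence extending it by zeros from index \<open>m\<close> on.\<close>

definition l_inf_fin :: "nat \<Rightarrow> (nat \<Rightarrow> complex) cnspace" where
  "l_inf_fin m = sup_seq_space {x. \<forall>i\<ge>m. x i = 0}"

definition c_zero :: "(nat \<Rightarrow> complex) cnspace" where
  "c_zero = sup_seq_space {x. x \<longlonglongrightarrow> 0}"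

definition l_inf :: "(nat \<Rightarrow> complex) cnspace" where
  "l_inf = sup_seq_space {x. bounded (range x)}"


section \<open>The space of essentially bounded functions\<close>

definition ess_bdd :: "'a measure \<Rightarrow> ('a \<Rightarrow> complex) set" where
  "ess_bdd M = {f \<in> borel_measurable M. \<exists>C. AE t in M. cmod (f t) \<le> C}"

definition ae_rel :: "'a measure \<Rightarrow> (('a \<Rightarrow> complex) \<times> ('a \<Rightarrow> complex)) set" where
  "ae_rel M = {(f, g). f \<in> ess_bdd M \<and> g \<in> ess_bdd M \<and> (AE t in M. f t = g t)}"

text \<open>
  Vectors are the classes modulo almost everywhere equality. The operations and the norm are
  those of representatives; they do not depend on the choice, so that each union below is a single
  class and the image in the norm is a singleton.
\<close>

definition L_inf :: "'a measure \<Rightarrow> ('a \<Rightarrow> complex) set cnspace" where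
  "L_inf M = \<lparr> vecs = ess_bdd M // ae_rel M,
     vzero = ae_rel M `` {\<lambda>_. 0},
     vadd = (\<lambda>A B. \<Union>f\<in>A. \<Union>g\<in>B. ae_rel M `` {\<lambda>t. f t + g t}),
     vscale = (\<lambda>a A. \<Union>f\<in>A. ae_rel M `` {\<lambda>t. a * f t}),
     vnorm = (\<lambda>A. the_elem ((\<lambda>f. real_of_ereal (esssup M (\<lambda>t. ereal (cmod (f t))))) ` A)) \<rparr>"


section \<open>Operators\<close>

text \<open>
  An operator is represented by a function of which only the values on the carrier of the domain
  matter.
\<close>

definition bounded_ops :: "'a cnspace \<Rightarrow> ('a \<Rightarrow> 'b::complex_banach) set" where
  "bounded_ops X = {T.
     (\<forall>x\<in>vecs X. \<forall>y\<in>vecs X. T (vadd X x y) = T x + T y) \<and>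
     (\<forall>a. \<forall>x\<in>vecs X. T (vscale X a x) = a *\<^sub>C T x) \<and>
     (\<exists>K. \<forall>x\<in>vecs X. norm (T x) \<le> K * vnorm X x)}"

definition op_norm :: "'a cnspace \<Rightarrow> ('a \<Rightarrow> 'b::complex_banach) \<Rightarrow> real" where
  "op_norm X T = (SUP x\<in>unit_ball X. norm (T x))"

definition RSE :: "'a cnspace \<Rightarrow> ('a \<Rightarrow> 'b::complex_banach) set" where
  "RSE X = {T \<in> bounded_ops X. \<exists>x0\<in>unit_sphere X. \<forall>x :: nat \<Rightarrow> 'a.
     (\<forall>n. x n \<in> unit_ball X) \<and> (\<lambda>n. norm (T (x n))) \<longlonglongrightarrow> op_norm X T \<longrightarrow>
     (\<exists>\<sigma> :: nat \<Rightarrow> nat. \<exists>\<theta>. strict_mono \<sigma> \<and> cmod \<theta> = 1 \<and> (\<lambda>n. T (x (\<sigma> n))) \<longlonglongrightarrow> \<theta> *\<^sub>C T x0)}"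

text \<open>The second space of the pair is the whole type \<^typ>\<open>'b\<close>, passed as a type token.\<close>

definition BPBp_RSE :: "'a cnspace \<Rightarrow> 'b::complex_banach itself \<Rightarrow> bool" where
  "BPBp_RSE X Y \<longleftrightarrow> (\<forall>\<epsilon>>0. \<exists>\<eta>>0. \<eta> < \<epsilon> \<and>
     (\<forall>T \<in> (bounded_ops X :: ('a \<Rightarrow> 'b) set). \<forall>x\<in>unit_sphere X.
        op_norm X T = 1 \<and> norm (T x) > 1 - \<eta> \<longrightarrow>
        (\<exists>S\<in>RSE X. \<exists>x0\<in>unit_sphere X. op_norm X S = 1 \<and> norm (S x0) = 1 \<and>
           op_norm X (\<lambda>z. S z - T z) < \<epsilon> \<and> vnorm X (vdiff X x x0) < \<epsilon>)))"

definition C_uniformly_convex :: "'b::complex_banach itself \<Rightarrow> bool" where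
  "C_uniformly_convex Y \<longleftrightarrow> (\<forall>\<epsilon>>0. \<exists>\<delta>>0. \<forall>y0 y1 :: 'b.
     (\<forall>w. cmod w = 1 \<longrightarrow> norm (y0 + w *\<^sub>C y1) \<le> 1) \<and> norm y1 > \<epsilon> \<longrightarrow> norm y0 < 1 - \<delta>)"

end

theory Submission
  imports Defs
begin

text \<open>
  Each of the four properties of pairs is equivalent to uniform convexity of \<open>Y\<close> separately, and all
  four domains are treated at once as order ideals of essentially bounded functions.

  \<^emph>\<open>Uniform convexity gives the property.\<close> Let \<open>T\<close> have norm 1 and let \<open>T x\<close> have norm close to 1.
  Where \<open>|x|\<close> stays away from 1 there is room to add functions to \<open>x\<close>, rotated by any unimodular
  number, without leaving the unit ball; hence \<open>T\<close> is small on functions living there. On the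
  remaining set \<open>A\<close> the phase \<open>u\<close> of \<open>x\<close> is a unimodular multiplier, and \<open>g \<mapsto> T (u g)\<close> is an
  operator on \<open>L\<^sub>\<infinity>(A)\<close> that almost attains its norm at the constant function 1. It remains to
  correct such an operator, and here the room argument is used again
  (\<open>multiplier_near_identity\<close>): if \<open>T ((1 + g) / 2)\<close> has norm close to 1, then multiplication by \<open>g\<close>
  before applying \<open>T\<close> changes \<open>T\<close> little, since \<open>|(1 + g) / 2|\<close> is well below 1 wherever \<open>g\<close> is
  not close to 1.

  The correction follows Lindenstrauss. Let \<open>F\<close> be a functional norming \<open>T 1\<close> and replace \<open>T\<close> by
  \<open>T + \<rho> F(T \<cdot>) T 1\<close>. A function \<open>g\<close> at which this operator almost attains its norm satisfies
  \<open>F (T g) \<approx> 1\<close> up to rotation, so that \<open>T ((1 + g) / 2)\<close> has norm close to 1. In place of moving the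
  point from 1 to \<open>g\<close>, the multiplier \<open>g\<close> is absorbed into the operator, which changes it little by the
  above. The point thus remains 1, and the iteration converges in operator norm to an operator
  attaining its norm at 1 (\<open>attain_norm_at_one\<close>). One more perturbation of the same kind makes
  all almost norm attaining sequences have images that converge, after rotation and along a
  subsequence (\<open>attain_strongly_at_one\<close>).

  \<^emph>\<open>The property gives uniform convexity.\<close> Suppose that \<open>y\<^sub>0 + w y\<^sub>1\<close> lies in the unit ball for all
  unimodular \<open>w\<close>, that \<open>y\<^sub>0\<close> has norm close to 1 and that \<open>y\<^sub>1\<close> is not small. With functionals
  concentrated on disjoint sets \<open>A\<close> and \<open>B\<close> one forms an operator of norm at most 1 that maps the
  indicator of \<open>A\<close> to \<open>y\<^sub>0\<close> and that of \<open>B\<close> to \<open>y\<^sub>1\<close>. A range strongly exposing \<open>S\<close> close to it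
  attains its norm at a point close to the indicator of \<open>A\<close>, hence also after adding \<open>\<plusminus> 1/2\<close> times the
  indicator of \<open>B\<close>. All values at which the norm of \<open>S\<close> is attained are rotations of a single
  vector, which forces \<open>S\<close> to vanish on the indicator of \<open>B\<close>, although \<open>y\<^sub>1\<close> is not small.
\<close>

section \<open>Norming functionals and ultrafilters\<close>

lemma minimal_element_below_chains:
  fixes S :: "'s::order set"
  assumes "S \<noteq> {}"
    and chain: "\<And>C. C \<subseteq> S \<Longrightarrow> C \<noteq> {} \<Longrightarrow> (\<And>x y. x \<in> C \<Longrightarrow> y \<in> C \<Longrightarrow> x \<le> y \<or> y \<le> x) \<Longrightarrow>
      \<exists>l\<in>S. \<forall>x\<in>C. l \<le> x"
  shows "\<exists>m\<in>S. \<forall>x\<in>S. x \<le> m \<longrightarrow> x = m"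
proof (rule predicate_Zorn[where P = "\<lambda>x y. y \<le> x"])
  show "partial_order_on S (relation_of (\<lambda>x y. y \<le> x) S)"
    by (auto simp: partial_order_on_def preorder_on_def refl_on_def trans_def antisym_def
        relation_of_def)
next
  fix C assume C: "C \<in> Chains (relation_of (\<lambda>x y. y \<le> x) S)"
  show "\<exists>u\<in>S. \<forall>a\<in>C. u \<le> a"
  proof (cases "C = {}")
    case True
    then show ?thesis using \<open>S \<noteq> {}\<close> by auto
  next
    case False
    show ?thesis
    proof (rule chain)
      show "C \<subseteq> S" using C unfolding Chains_def relation_of_def by fast
      show "x \<le> y \<or> y \<le> x" if "x \<in> C" "y \<in> C" for x y
        using C that unfolding Chains_def relation_of_def by fast
    qed (use False in auto)
  qed
qed

definition sublinear :: "('v::real_vector \<Rightarrow> real) \<Rightarrow> bool" where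
  "sublinear p \<longleftrightarrow> (\<forall>x y. p (x + y) \<le> p x + p y) \<and> (\<forall>r\<ge>0. \<forall>x. p (r *\<^sub>R x) \<le> r * p x)"

lemma sublinear_lower_bound:
  assumes "sublinear p"
  shows "- p (- x) \<le> p x" "0 \<le> p 0"
proof -
  have "p (0 + 0) \<le> p 0 + p 0" using assms unfolding sublinear_def by blast
  then show *: "0 \<le> p 0" by simp
  have "p (x + - x) \<le> p x + p (- x)" using assms unfolding sublinear_def by blast
  then show "- p (- x) \<le> p x" using * by simp
qed

text \<open>
  The largest sublinear functional below \<open>p\<close> whose value at \<open>- y\<close> is at most \<open>- p y\<close>.
  A minimal sublinear functional is a fixed point of this construction for every \<open>y\<close>, and this
  is what makes it additive.
\<close>

definition tilt :: "('v::real_vector \<Rightarrow> real) \<Rightarrow> 'v \<Rightarrow> 'v \<Rightarrow> real" where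
  "tilt p y x = (INF t\<in>{0..}. p (x + t *\<^sub>R y) - t * p y)"

lemma tilt_bounded_below:
  assumes "sublinear p"
  shows "bdd_below ((\<lambda>t. p (x + t *\<^sub>R y) - t * p y) ` {0..})"
proof (rule bdd_belowI2)
  fix t :: real assume "t \<in> {0..}"
  then have "p (t *\<^sub>R y) \<le> t * p y" using assms unfolding sublinear_def by auto
  moreover have "t * p y \<le> p (t *\<^sub>R y)"
  proof (cases "t = 0")
    case True
    then show ?thesis using sublinear_lower_bound[OF assms] by simp
  next
    case False
    with \<open>t \<in> {0..}\<close> have "t > 0" by simp
    then have "1 / t \<ge> 0" by simp
    then have "p ((1 / t) *\<^sub>R (t *\<^sub>R y)) \<le> (1 / t) * p (t *\<^sub>R y)"
      using assms unfolding sublinear_def by blast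
    then show ?thesis using \<open>t > 0\<close> by (simp add: field_simps)
  qed
  moreover have "p ((x + t *\<^sub>R y) + (- x)) \<le> p (x + t *\<^sub>R y) + p (- x)"
    using assms unfolding sublinear_def by blast
  ultimately show "- p (- x) \<le> p (x + t *\<^sub>R y) - t * p y" by simp
qed

lemma tilt_le:
  assumes "sublinear p" "t \<ge> 0"
  shows "tilt p y x \<le> p (x + t *\<^sub>R y) - t * p y"
  unfolding tilt_def by (rule cINF_lower[OF tilt_bounded_below[OF assms(1)]]) (use assms in auto)

lemma sublinear_tilt:
  assumes p: "sublinear p"
  shows "sublinear (tilt p y)"
  unfolding sublinear_def
proof (intro conjI allI impI)
  fix x z
  have "tilt p y (x + z) - (p (z + s *\<^sub>R y) - s * p y) \<le> p (x + t *\<^sub>R y) - t * p y"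
    if "s \<ge> 0" "t \<ge> 0" for s t
  proof -
    have "p ((x + t *\<^sub>R y) + (z + s *\<^sub>R y)) \<le> p (x + t *\<^sub>R y) + p (z + s *\<^sub>R y)"
      using p unfolding sublinear_def by blast
    moreover have "tilt p y (x + z) \<le> p ((x + z) + (t + s) *\<^sub>R y) - (t + s) * p y"
      using that by (intro tilt_le p) auto
    moreover have "(x + z) + (t + s) *\<^sub>R y = (x + t *\<^sub>R y) + (z + s *\<^sub>R y)"
      by (simp add: algebra_simps)
    ultimately show ?thesis by (simp add: algebra_simps)
  qed
  then have "tilt p y (x + z) - (p (z + s *\<^sub>R y) - s * p y) \<le> tilt p y x" if "s \<ge> 0" for s
    unfolding tilt_def[of p y x] using that by (intro cINF_greatest) auto
  then have "tilt p y (x + z) - tilt p y x \<le> p (z + s *\<^sub>R y) - s * p y" if "s \<ge> 0" for s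
    using that by (simp add: algebra_simps)
  then have "tilt p y (x + z) - tilt p y x \<le> tilt p y z"
    unfolding tilt_def[of p y z] by (intro cINF_greatest) auto
  then show "tilt p y (x + z) \<le> tilt p y x + tilt p y z" by simp
next
  fix r :: real and x assume r: "r \<ge> 0"
  have *: "tilt p y (r *\<^sub>R x) \<le> r * (p (x + t *\<^sub>R y) - t * p y)" if "t \<ge> 0" for t
  proof -
    have "tilt p y (r *\<^sub>R x) \<le> p (r *\<^sub>R x + (r * t) *\<^sub>R y) - (r * t) * p y"
      using r that by (intro tilt_le p) auto
    also have "r *\<^sub>R x + (r * t) *\<^sub>R y = r *\<^sub>R (x + t *\<^sub>R y)" by (simp add: algebra_simps)
    also have "p \<dots> \<le> r * p (x + t *\<^sub>R y)" using p r unfolding sublinear_def by blast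
    finally show ?thesis by (simp add: algebra_simps)
  qed
  show "tilt p y (r *\<^sub>R x) \<le> r * tilt p y x"
  proof (cases "r = 0")
    case True
    then show ?thesis using *[of 0] by simp
  next
    case False
    with r have "r > 0" by simp
    have "tilt p y (r *\<^sub>R x) / r \<le> tilt p y x"
      unfolding tilt_def[of p y x]
    proof (rule cINF_greatest)
      fix t :: real assume "t \<in> {0..}"
      then show "tilt p y (r *\<^sub>R x) / r \<le> p (x + t *\<^sub>R y) - t * p y"
        using *[of t] \<open>r > 0\<close> by (simp add: pos_divide_le_eq mult.commute)
    qed simp
    then show ?thesis using \<open>r > 0\<close> by (simp add: field_simps)
  qed
qed

text \<open>
  Minimality in the pointwise order replaces the extension procedure: a minimal sublinear functional
  equals all its tilts, hence is superadditive as well.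
\<close>

lemma linear_below_sublinear:
  assumes p: "sublinear p"
  shows "\<exists>f. linear f \<and> (\<forall>x. f x \<le> p x)"
proof -
  define S where "S = {q. sublinear q \<and> q \<le> p}"
  have "\<exists>m\<in>S. \<forall>q\<in>S. q \<le> m \<longrightarrow> q = m"
  proof (rule minimal_element_below_chains)
    show "S \<noteq> {}" using p unfolding S_def by auto
    fix C assume C: "C \<subseteq> S" "C \<noteq> {}" and ch: "\<And>x y. x \<in> C \<Longrightarrow> y \<in> C \<Longrightarrow> x \<le> y \<or> y \<le> x"
    define l where "l = (\<lambda>x. INF q\<in>C. q x)"
    have bdd: "bdd_below ((\<lambda>q. q x) ` C)" for x
    proof (rule bdd_belowI2)
      fix q assume "q \<in> C"
      with C have "sublinear q" "q \<le> p" unfolding S_def by auto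
      then show "- p (- x) \<le> q x"
        using sublinear_lower_bound(1)[of q x] le_funD[of q p "- x"] by simp
    qed
    have le: "l x \<le> q x" if "q \<in> C" for q x
      unfolding l_def by (rule cINF_lower[OF bdd that])
    have "sublinear l"
      unfolding sublinear_def
    proof (intro conjI allI impI)
      fix x y
      have "l (x + y) - q y \<le> q' x" if qs: "q \<in> C" "q' \<in> C" for q q'
      proof -
        obtain r where r: "r \<in> C" "r \<le> q" "r \<le> q'"
          using ch[OF qs] qs by blast
        have "l (x + y) \<le> r (x + y)" by (rule le[OF r(1)])
        also have "\<dots> \<le> r x + r y" using r C unfolding S_def sublinear_def by blast
        also have "\<dots> \<le> q' x + q y" using r by (intro add_mono) (auto simp: le_fun_def)
        finally show ?thesis by simp
      qed
      then have "l (x + y) - q y \<le> (INF r\<in>C. r x)" if "q \<in> C" for q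
        using that C(2) by (intro cINF_greatest) simp_all
      then have "l (x + y) - l x \<le> q y" if "q \<in> C" for q
        using that by (simp add: l_def algebra_simps)
      then have "l (x + y) - l x \<le> (INF q\<in>C. q y)"
        using C by (intro cINF_greatest) auto
      then show "l (x + y) \<le> l x + l y" by (simp add: l_def)
    next
      fix r :: real and x assume r: "r \<ge> 0"
      have *: "l (r *\<^sub>R x) \<le> r * q x" if "q \<in> C" for q
      proof -
        have "sublinear q" using C that unfolding S_def by auto
        then have "q (r *\<^sub>R x) \<le> r * q x" using r unfolding sublinear_def by blast
        then show ?thesis using le[OF that, of "r *\<^sub>R x"] by simp
      qed
      show "l (r *\<^sub>R x) \<le> r * l x"
      proof (cases "r = 0")
        case True
        then show ?thesis using * C by auto
      next
        case False
        with r have "r > 0" by simp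
        have "l (r *\<^sub>R x) / r \<le> (INF q\<in>C. q x)"
          using C(2)
        proof (rule cINF_greatest)
          fix q assume "q \<in> C"
          then show "l (r *\<^sub>R x) / r \<le> q x"
            using *[of q] \<open>r > 0\<close> by (simp add: pos_divide_le_eq mult.commute)
        qed
        then show ?thesis using \<open>r > 0\<close> by (simp add: field_simps l_def)
      qed
    qed
    moreover have "l \<le> p"
    proof (rule le_funI)
      fix x
      obtain q where q: "q \<in> C" using C by auto
      then have "q \<le> p" using C unfolding S_def by auto
      then show "l x \<le> p x" using le[OF q, of x] le_funD[of q p x] by simp
    qed
    ultimately have "l \<in> S" unfolding S_def by simp
    moreover have "\<forall>q\<in>C. l \<le> q" using le by (auto simp: le_fun_def)
    ultimately show "\<exists>l\<in>S. \<forall>q\<in>C. l \<le> q" by blast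
  qed
  then obtain m where m: "sublinear m" "m \<le> p" and min: "\<And>q. q \<in> S \<Longrightarrow> q \<le> m \<Longrightarrow> q = m"
    unfolding S_def by auto
  have tilt: "tilt m y = m" for y
  proof (rule min)
    show *: "tilt m y \<le> m" using tilt_le[OF m(1), of 0 y] by (auto simp: le_fun_def)
    show "tilt m y \<in> S"
      using order_trans[OF * m(2)] sublinear_tilt[OF m(1)] unfolding S_def by simp
  qed
  have add: "m (x + y) = m x + m y" for x y
  proof (rule antisym)
    show "m (x + y) \<le> m x + m y" using m unfolding sublinear_def by blast
    have "m x \<le> m (x + 1 *\<^sub>R y) - 1 * m y"
      using tilt_le[OF m(1), of 1 y x] unfolding tilt by simp
    then show "m x + m y \<le> m (x + y)" by simp
  qed
  have zero: "m 0 = 0" using add[of 0 0] by simp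
  have neg: "m (- x) = - m x" for x using add[of x "- x"] zero by simp
  have pos: "m (r *\<^sub>R x) = r * m x" if "r \<ge> 0" for r x
  proof (rule antisym)
    show "m (r *\<^sub>R x) \<le> r * m x" using m that unfolding sublinear_def by blast
    have "m (r *\<^sub>R (- x)) \<le> r * m (- x)" using m that unfolding sublinear_def by blast
    then show "r * m x \<le> m (r *\<^sub>R x)" using neg by simp
  qed
  have "linear m"
  proof
    show "m (x + y) = m x + m y" for x y by (rule add)
    show "m (r *\<^sub>R x) = r *\<^sub>R m x" for r x
      using pos[of r x] pos[of "- r" x] neg[of "r *\<^sub>R x"] by (cases "r \<ge> 0") auto
  qed
  then show ?thesis using m(2) by (auto simp: le_fun_def)
qed

text \<open>A linear functional below the tilt of the norm at \<open>y\<close> is at most \<open>- norm y\<close> at \<open>- y\<close>.\<close>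

lemma norming_functional_real:
  fixes y :: "'v::real_normed_vector"
  shows "\<exists>f. linear f \<and> (\<forall>x. f x \<le> norm x) \<and> f y = norm y"
proof -
  have n: "sublinear (norm :: 'v \<Rightarrow> real)"
    unfolding sublinear_def by (auto simp: norm_triangle_ineq)
  obtain f where f: "linear f" "\<And>x. f x \<le> tilt norm y x"
    using linear_below_sublinear[OF sublinear_tilt[OF n]] by blast
  have le: "f x \<le> norm x" for x using f(2)[of x] tilt_le[OF n, of 0 y x] by simp
  have "f (- y) \<le> - norm y" using f(2)[of "- y"] tilt_le[OF n, of 1 y "- y"] by simp
  then have "norm y \<le> f y" using linear_neg[OF f(1), of y] by simp
  then show ?thesis using f(1) le antisym[OF le[of y]] by blast
qed

lemma rotation_to_modulus: "\<exists>\<theta>. cmod \<theta> = 1 \<and> \<theta> * z = of_real (cmod z)"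
proof (cases "z = 0")
  case False
  have "cnj z / of_real (cmod z) * z = of_real ((cmod z)\<^sup>2) / of_real (cmod z)"
    unfolding complex_norm_square by (simp add: mult.commute)
  also have "\<dots> = of_real (cmod z)" using False by (simp add: power2_eq_square)
  finally have "cnj z / of_real (cmod z) * z = of_real (cmod z)" .
  moreover have "cmod (cnj z / of_real (cmod z)) = 1" using False by (simp add: norm_divide)
  ultimately show ?thesis by blast
qed (rule exI[of _ 1], simp)

text \<open>The complex functional is recovered from its real part \<open>f\<close> as \<open>f y - \<i> f (\<i> y)\<close>.\<close>

lemma norming_functional:
  fixes y :: "'b::complex_banach"
  shows "\<exists>F :: 'b \<Rightarrow> complex. (\<forall>u v. F (u + v) = F u + F v) \<and> (\<forall>a u. F (a *\<^sub>C u) = a * F u) \<and>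
    (\<forall>u. cmod (F u) \<le> norm u) \<and> F y = of_real (norm y)"
proof -
  obtain f where f: "linear f" "\<And>x :: 'b. f x \<le> norm x" "f y = norm y"
    using norming_functional_real[of y] by blast
  define F where "F u = Complex (f u) (- f (\<i> *\<^sub>C u))" for u
  have add: "F (u + v) = F u + F v" for u v
    by (simp add: F_def linear_add[OF f(1)] scaleC_add_right complex_eq_iff)
  have real: "f (complex_of_real r *\<^sub>C u) = r * f u" for r u
    by (simp add: scaleC_of_real linear_scale[OF f(1)])
  have scale: "F (a *\<^sub>C u) = a * F u" for a u
  proof -
    have a: "a = of_real (Re a) + of_real (Im a) * \<i>" by (simp add: complex_eq_iff)
    have 1: "f (a *\<^sub>C u) = Re a * f u + Im a * f (\<i> *\<^sub>C u)"
      by (subst a) (simp only: scaleC_add_left linear_add[OF f(1)] real scaleC_scaleC[symmetric])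
    have a': "\<i> * a = of_real (- Im a) + of_real (Re a) * \<i>" by (simp add: complex_eq_iff)
    have "f ((\<i> * a) *\<^sub>C u) = - Im a * f u + Re a * f (\<i> *\<^sub>C u)"
      by (subst a') (simp only: scaleC_add_left linear_add[OF f(1)] real scaleC_scaleC[symmetric])
    then show ?thesis using 1 by (simp add: F_def complex_eq_iff scaleC_scaleC)
  qed
  have bound: "cmod (F u) \<le> norm u" for u
  proof -
    \<comment> \<open>Rotating \<open>u\<close> makes the value of \<open>F\<close> real, and then it is a value of \<open>f\<close>.\<close>
    obtain w where w: "cmod w = 1" "w * F u = of_real (cmod (F u))"
      using rotation_to_modulus by blast
    then have "F (w *\<^sub>C u) = of_real (cmod (F u))" by (simp add: scale)
    then have "f (w *\<^sub>C u) = cmod (F u)" by (simp add: F_def complex_eq_iff)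
    then show ?thesis using f(2)[of "w *\<^sub>C u"] w by (simp add: norm_scaleC)
  qed
  have "F y = of_real (norm y)"
  proof -
    have "Re (F y) = norm y" by (simp add: F_def f)
    moreover have "(Re (F y))\<^sup>2 + (Im (F y))\<^sup>2 \<le> (norm y)\<^sup>2"
      using bound[of y] by (metis cmod_power2 norm_ge_zero power_mono)
    ultimately show ?thesis by (simp add: complex_eq_iff)
  qed
  then show ?thesis using add scale bound by blast
qed

lemma ultrafilter_below:
  fixes F :: "'s filter"
  assumes "F \<noteq> bot"
  shows "\<exists>U\<le>F. U \<noteq> bot \<and> (\<forall>P. eventually P U \<or> eventually (\<lambda>x. \<not> P x) U)"
proof -
  define S where "S = {G. G \<noteq> bot \<and> G \<le> F}"
  have "\<exists>U\<in>S. \<forall>G\<in>S. G \<le> U \<longrightarrow> G = U"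
  proof (rule minimal_element_below_chains)
    show "S \<noteq> {}" using assms unfolding S_def by auto
    fix C assume C: "C \<subseteq> S" "C \<noteq> {}" and ch: "\<And>x y. x \<in> C \<Longrightarrow> y \<in> C \<Longrightarrow> x \<le> y \<or> y \<le> x"
    have "eventually P (Inf C) \<longleftrightarrow> (\<exists>G\<in>C. eventually P G)" for P
    proof (rule eventually_Inf_base[OF C(2)])
      fix G H assume "G \<in> C" "H \<in> C"
      then show "\<exists>x\<in>C. x \<le> inf G H" using ch[of G H] by (auto intro: le_infI)
    qed
    then have "Inf C \<noteq> bot" using C unfolding S_def trivial_limit_def by blast
    moreover obtain G where "G \<in> C" using C(2) by blast
    then have "Inf C \<le> F" using C(1) Inf_lower[of G C] unfolding S_def by auto
    ultimately show "\<exists>l\<in>S. \<forall>x\<in>C. l \<le> x" unfolding S_def using Inf_lower by auto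
  qed
  then obtain U where U: "U \<noteq> bot" "U \<le> F" and min: "\<And>G. G \<in> S \<Longrightarrow> G \<le> U \<Longrightarrow> G = U"
    unfolding S_def by auto
  have "eventually P U" if "\<not> eventually (\<lambda>x. \<not> P x) U" for P
  proof -
    have "inf U (principal {x. P x}) \<noteq> bot"
      using that by (simp add: trivial_limit_def eventually_inf_principal)
    then have "inf U (principal {x. P x}) = U"
      using U by (intro min) (auto simp: S_def intro: le_infI1)
    then have "eventually P U \<longleftrightarrow> eventually P (inf U (principal {x. P x}))" by simp
    then show ?thesis by (simp add: eventually_inf_principal)
  qed
  then show ?thesis using U by blast
qed

lemma ultrafilter_bounded_limit:
  fixes f :: "'s \<Rightarrow> complex"
  assumes U: "U \<noteq> bot" "\<And>P. eventually P U \<or> eventually (\<lambda>x. \<not> P x) U"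
    and bd: "eventually (\<lambda>x. cmod (f x) \<le> C) U"
  shows "\<exists>l. (f \<longlongrightarrow> l) U"
proof -
  have "\<exists>l\<in>cball 0 C. inf (nhds l) (filtermap f U) \<noteq> bot"
    using compact_cball[of "0::complex" C] bd U(1) unfolding compact_filter
    by (auto simp: eventually_filtermap filtermap_bot_iff)
  then obtain l where l: "inf (nhds l) (filtermap f U) \<noteq> bot" by blast
  have "eventually (\<lambda>x. f x \<in> S) U" if "open S" "l \<in> S" for S
  proof (rule ccontr)
    assume "\<not> eventually (\<lambda>x. f x \<in> S) U"
    then have "eventually (\<lambda>x. f x \<notin> S) U" using U(2) by blast
    then have "eventually (\<lambda>z. z \<notin> S) (filtermap f U)" by (simp add: eventually_filtermap)
    moreover have "eventually (\<lambda>z. z \<in> S) (nhds l)" using that eventually_nhds by blast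
    ultimately have "eventually (\<lambda>z. False) (inf (nhds l) (filtermap f U))"
      unfolding eventually_inf by auto
    then show False using l by (simp add: trivial_limit_def)
  qed
  then show ?thesis unfolding tendsto_def by blast
qed

section \<open>Operators on essentially bounded functions\<close>

lemma ess_bddI:
  "f \<in> borel_measurable M \<Longrightarrow> AE t in M. cmod (f t) \<le> C \<Longrightarrow> f \<in> ess_bdd M"
  unfolding ess_bdd_def by blast

lemma ess_bdd_measurable: "f \<in> ess_bdd M \<Longrightarrow> f \<in> borel_measurable M"
  unfolding ess_bdd_def by blast

lemma ess_bdd_bound:
  assumes "f \<in> ess_bdd M"
  obtains C where "C > 0" "AE t in M. cmod (f t) \<le> C"
proof -
  obtain C where C: "AE t in M. cmod (f t) \<le> C" using assms unfolding ess_bdd_def by blast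
  have "AE t in M. cmod (f t) \<le> max C 1" using C by eventually_elim auto
  then show ?thesis by (intro that[of "max C 1"]) auto
qed

lemma ess_bdd_const [simp]: "(\<lambda>_. c) \<in> ess_bdd M"
  by (rule ess_bddI[where C = "cmod c"]) auto

lemma ess_bdd_add:
  assumes "f \<in> ess_bdd M" "g \<in> ess_bdd M"
  shows "(\<lambda>t. f t + g t) \<in> ess_bdd M"
proof -
  note [measurable] = assms[THEN ess_bdd_measurable]
  obtain C D where CD: "AE t in M. cmod (f t) \<le> C" "AE t in M. cmod (g t) \<le> D"
    using assms unfolding ess_bdd_def by blast
  have "AE t in M. cmod (f t + g t) \<le> C + D"
    using CD by eventually_elim (metis add_mono norm_triangle_le)
  then show ?thesis by (intro ess_bddI) measurable
qed

lemma ess_bdd_mult: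
  assumes "f \<in> ess_bdd M" "g \<in> ess_bdd M"
  shows "(\<lambda>t. f t * g t) \<in> ess_bdd M"
proof -
  note [measurable] = assms[THEN ess_bdd_measurable]
  obtain C where C: "C > 0" "AE t in M. cmod (f t) \<le> C" using ess_bdd_bound[OF assms(1)] .
  obtain D where D: "D > 0" "AE t in M. cmod (g t) \<le> D" using ess_bdd_bound[OF assms(2)] .
  have "AE t in M. cmod (f t * g t) \<le> C * D"
    using C(2) D(2) by eventually_elim (use C D in \<open>simp add: norm_mult mult_mono\<close>)
  then show ?thesis by (intro ess_bddI) measurable
qed

lemma ess_bdd_scale: "f \<in> ess_bdd M \<Longrightarrow> (\<lambda>t. a * f t) \<in> ess_bdd M"
  by (rule ess_bdd_mult) simp_all

lemma ess_bdd_if: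
  assumes "f \<in> ess_bdd M" "Measurable.pred M P"
  shows "(\<lambda>t. if P t then f t else 0) \<in> ess_bdd M"
proof -
  note [measurable] = ess_bdd_measurable[OF assms(1)] assms(2)
  obtain C where C: "C > 0" "AE t in M. cmod (f t) \<le> C" using ess_bdd_bound[OF assms(1)] .
  have "AE t in M. cmod (if P t then f t else 0) \<le> C"
    using C(2) by eventually_elim (use C(1) in auto)
  then show ?thesis by (intro ess_bddI) measurable
qed

text \<open>
  The bound is tested against almost everywhere bounds of the argument, so that the members do not
  distinguish functions agreeing almost everywhere: they are the operators on \<open>L\<^sub>\<infinity>(M)\<close> of
  norm at most \<open>K\<close>.
\<close>

definition ops_bounded_by :: "'a measure \<Rightarrow> real \<Rightarrow> (('a \<Rightarrow> complex) \<Rightarrow> 'b::complex_banach) set" where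
  "ops_bounded_by M K = {T.
     (\<forall>f\<in>ess_bdd M. \<forall>g\<in>ess_bdd M. T (\<lambda>t. f t + g t) = T f + T g) \<and>
     (\<forall>a. \<forall>f\<in>ess_bdd M. T (\<lambda>t. a * f t) = a *\<^sub>C T f) \<and>
     (\<forall>f\<in>ess_bdd M. \<forall>C\<ge>0. (AE t in M. cmod (f t) \<le> C) \<longrightarrow> norm (T f) \<le> K * C)}"

lemma ops_add:
  "T \<in> ops_bounded_by M K \<Longrightarrow> f \<in> ess_bdd M \<Longrightarrow> g \<in> ess_bdd M \<Longrightarrow> T (\<lambda>t. f t + g t) = T f + T g"
  unfolding ops_bounded_by_def by blast

lemma ops_scale:
  "T \<in> ops_bounded_by M K \<Longrightarrow> f \<in> ess_bdd M \<Longrightarrow> T (\<lambda>t. a * f t) = a *\<^sub>C T f"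
  unfolding ops_bounded_by_def by blast

lemma ops_bound:
  "T \<in> ops_bounded_by M K \<Longrightarrow> f \<in> ess_bdd M \<Longrightarrow> 0 \<le> C \<Longrightarrow> AE t in M. cmod (f t) \<le> C \<Longrightarrow>
    norm (T f) \<le> K * C"
  unfolding ops_bounded_by_def by blast

lemma ops_diff:
  assumes T: "T \<in> ops_bounded_by M K" and f: "f \<in> ess_bdd M" and g: "g \<in> ess_bdd M"
  shows "T (\<lambda>t. f t - g t) = T f - T g"
proof -
  have "T (\<lambda>t. f t + (- 1) * g t) = T f + (- 1) *\<^sub>C T g"
    using ops_add[OF T f ess_bdd_scale[OF g, of "- 1"]] ops_scale[OF T g, of "- 1"] by simp
  then show ?thesis by simp
qed

lemma ops_cong_AE:
  assumes T: "T \<in> ops_bounded_by M K" and f: "f \<in> ess_bdd M" and g: "g \<in> ess_bdd M"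
    and "AE t in M. f t = g t"
  shows "T f = T g"
proof -
  have "(\<lambda>t. f t - g t) \<in> ess_bdd M"
    using ess_bdd_add[OF f ess_bdd_scale[OF g, of "- 1"]] by simp
  moreover have "AE t in M. cmod (f t - g t) \<le> 0" using assms(4) by eventually_elim simp
  ultimately have "norm (T (\<lambda>t. f t - g t)) \<le> K * 0" by (intro ops_bound[OF T]) auto
  then show ?thesis by (simp add: ops_diff[OF T f g])
qed

lemma ops_bounded_byI:
  assumes add: "\<And>f g. f \<in> ess_bdd M \<Longrightarrow> g \<in> ess_bdd M \<Longrightarrow> T (\<lambda>t. f t + g t) = T f + T g"
    and scale: "\<And>a f. f \<in> ess_bdd M \<Longrightarrow> T (\<lambda>t. a * f t) = a *\<^sub>C T f"
    and ball: "\<And>f. f \<in> ess_bdd M \<Longrightarrow> AE t in M. cmod (f t) \<le> 1 \<Longrightarrow> norm (T f) \<le> K"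
  shows "T \<in> ops_bounded_by M K"
proof -
  have "norm (T f) \<le> K * C" if f: "f \<in> ess_bdd M" "AE t in M. cmod (f t) \<le> C" and C: "C \<ge> 0" for f C
  proof -
    have pos: "norm (T f) \<le> K * D" if "D > 0" "C \<le> D" for D
    proof -
      have "AE t in M. cmod (of_real (1 / D) * f t) \<le> 1"
        using f(2) by eventually_elim (use that in \<open>simp add: norm_mult norm_divide field_simps\<close>)
      then have "norm (T (\<lambda>t. of_real (1 / D) * f t)) \<le> K"
        by (intro ball ess_bdd_scale f)
      then have "norm (of_real (1 / D) *\<^sub>C T f) \<le> K" unfolding scale[OF f(1)] .
      then show ?thesis using that by (simp add: norm_scaleC norm_divide field_simps)
    qed
    show ?thesis
    proof (cases "C = 0")
      case True
      have K: "K \<ge> 0" using pos[of "1"] True by (smt (verit) norm_ge_zero)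
      have "norm (T f) \<le> e" if "e > 0" for e
      proof -
        have "norm (T f) \<le> K * (e / (K + 1))" using K that True by (intro pos) auto
        also have "\<dots> \<le> e" using K that by (simp add: field_simps)
        finally show ?thesis .
      qed
      then show ?thesis using True field_le_epsilon[of "norm (T f)" 0] by simp
    qed (use pos[of C] C in auto)
  qed
  then show ?thesis unfolding ops_bounded_by_def using add scale by blast
qed

lemma ops_plus:
  assumes S: "S \<in> ops_bounded_by M K" and T: "T \<in> ops_bounded_by M L"
  shows "(\<lambda>f. S f + T f) \<in> ops_bounded_by M (K + L)"
proof (rule ops_bounded_byI)
  fix f assume f: "f \<in> ess_bdd M" "AE t in M. cmod (f t) \<le> 1"
  show "norm (S f + T f) \<le> K + L"
    using ops_bound[OF S f(1) _ f(2)] ops_bound[OF T f(1) _ f(2)] norm_triangle_ineq[of "S f" "T f"]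
    by simp
qed (simp_all add: ops_add[OF S] ops_add[OF T] ops_scale[OF S] ops_scale[OF T] scaleC_add_right)

lemma ops_scaleC:
  assumes T: "T \<in> ops_bounded_by M K"
  shows "(\<lambda>f. c *\<^sub>C T f) \<in> ops_bounded_by M (cmod c * K)"
proof (rule ops_bounded_byI)
  fix f assume f: "f \<in> ess_bdd M" "AE t in M. cmod (f t) \<le> 1"
  show "norm (c *\<^sub>C T f) \<le> cmod c * K"
    using ops_bound[OF T f(1) _ f(2)] by (simp add: norm_scaleC mult_left_mono)
qed (simp_all add: ops_add[OF T] ops_scale[OF T] scaleC_add_right scaleC_scaleC mult.commute)

lemma ops_minus:
  assumes "S \<in> ops_bounded_by M K" "T \<in> ops_bounded_by M L"
  shows "(\<lambda>f. S f - T f) \<in> ops_bounded_by M (K + L)"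
  using ops_plus[OF assms(1) ops_scaleC[OF assms(2), of "- 1"]] by simp

lemma ops_multiply:
  assumes T: "T \<in> ops_bounded_by M K"
    and g: "g \<in> ess_bdd M" "AE t in M. cmod (g t) \<le> 1"
  shows "(\<lambda>f. T (\<lambda>t. g t * f t)) \<in> ops_bounded_by M K"
proof (rule ops_bounded_byI)
  fix f assume f: "f \<in> ess_bdd M" "AE t in M. cmod (f t) \<le> 1"
  have "AE t in M. cmod (g t * f t) \<le> 1"
    using g(2) f(2) by eventually_elim (simp add: norm_mult mult_le_one)
  then show "norm (T (\<lambda>t. g t * f t)) \<le> K"
    using ops_bound[OF T ess_bdd_mult[OF g(1) f(1)], of 1] by simp
next
  fix f h assume "f \<in> ess_bdd M" "h \<in> ess_bdd M"
  then show "T (\<lambda>t. g t * (f t + h t)) = T (\<lambda>t. g t * f t) + T (\<lambda>t. g t * h t)"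
    using ops_add[OF T ess_bdd_mult[OF g(1)] ess_bdd_mult[OF g(1)]] by (simp add: distrib_left)
next
  fix a f assume "f \<in> ess_bdd M"
  then show "T (\<lambda>t. g t * (a * f t)) = a *\<^sub>C T (\<lambda>t. g t * f t)"
    using ops_scale[OF T ess_bdd_mult[OF g(1)]] by (simp add: mult.left_commute)
qed

lemma ops_rank_one:
  assumes T: "T \<in> ops_bounded_by M K"
    and F: "\<And>u v. F (u + v) = F u + F v" "\<And>a u. F (a *\<^sub>C u) = a * F u" "\<And>u. cmod (F u) \<le> norm u"
  shows "(\<lambda>f. F (T f) *\<^sub>C y) \<in> ops_bounded_by M (K * norm y)"
proof (rule ops_bounded_byI)
  fix f assume f: "f \<in> ess_bdd M" "AE t in M. cmod (f t) \<le> 1"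
  have "cmod (F (T f)) \<le> K"
    using ops_bound[OF T f(1) _ f(2)] F(3)[of "T f"] by simp
  then show "norm (F (T f) *\<^sub>C y) \<le> K * norm y" by (simp add: norm_scaleC mult_right_mono)
qed (simp_all add: ops_add[OF T] ops_scale[OF T] F scaleC_add_left scaleC_scaleC)

section \<open>Multipliers that nearly preserve the norm\<close>

text \<open>Uniform convexity of the disc with an explicit modulus, by the parallelogram law.\<close>

lemma midpoint_in_disc:
  fixes a b :: complex
  assumes "cmod a \<le> 1" "cmod b \<le> 1" "\<tau> \<ge> 0" "cmod (b - a) > \<tau>"
  shows "cmod ((a + b) / 2) \<le> 1 - \<tau>\<^sup>2 / 8"
proof -
  have par: "(cmod (a + b))\<^sup>2 + (cmod (b - a))\<^sup>2 = 2 * (cmod a)\<^sup>2 + 2 * (cmod b)\<^sup>2"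
    unfolding cmod_power2 by (simp add: power2_eq_square algebra_simps)
  have "(cmod a)\<^sup>2 \<le> 1" "(cmod b)\<^sup>2 \<le> 1" using assms by (auto simp: power_le_one)
  moreover have "\<tau>\<^sup>2 \<le> (cmod (b - a))\<^sup>2" using assms by (intro power_mono) auto
  ultimately have "(cmod (a + b))\<^sup>2 \<le> 4 - \<tau>\<^sup>2" using par by linarith
  then have sq: "(cmod ((a + b) / 2))\<^sup>2 \<le> 1 - \<tau>\<^sup>2 / 4" by (simp add: norm_divide power_divide)
  also have "\<dots> \<le> (1 - \<tau>\<^sup>2 / 8)\<^sup>2"
    using zero_le_power2[of "\<tau>\<^sup>2 / 8"] by (simp add: power2_diff)
  finally have *: "(cmod ((a + b) / 2))\<^sup>2 \<le> (1 - \<tau>\<^sup>2 / 8)\<^sup>2" .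
  have "\<tau>\<^sup>2 \<le> 4" using sq zero_le_power2[of "cmod ((a + b) / 2)"] by linarith
  then show ?thesis using power2_le_imp_le[OF *] by simp
qed

text \<open>
  Where \<open>g\<close> is far from 1, the midpoint \<open>(1 + g) / 2\<close> stays at distance \<open>\<kappa>\<close> from the unit circle,
  so that functions of size \<open>\<kappa>\<close> can be added to it there. As the image of the midpoint almost has
  norm 1, uniform convexity makes \<open>T\<close> small on them. The measure is quantified after \<open>\<gamma>\<close>, because the
  lemma will be applied to restrictions of a given measure to sets that depend on the operator.
\<close>

lemma multiplier_near_identity:
  assumes Y: "C_uniformly_convex TYPE('b::complex_banach)" and \<tau>: "\<tau> > 0"
  shows "\<exists>\<gamma>>0. \<forall>M :: 'a measure. \<forall>T \<in> (ops_bounded_by M 1 :: (('a \<Rightarrow> complex) \<Rightarrow> 'b) set).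
    \<forall>g\<in>ess_bdd M. (AE t in M. cmod (g t) \<le> 1) \<and> norm (T (\<lambda>t. (1 + g t) / 2)) > 1 - \<gamma> \<longrightarrow>
    (\<lambda>f. T (\<lambda>t. g t * f t) - T f) \<in> ops_bounded_by M \<tau>"
proof -
  define \<kappa> where "\<kappa> = (\<tau> / 2)\<^sup>2 / 8"
  have \<kappa>: "\<kappa> > 0" using \<tau> by (simp add: \<kappa>_def)
  obtain \<delta> where \<delta>: "\<delta> > 0" and convex: "\<And>y0 y1 :: 'b.
      (\<And>w. cmod w = 1 \<Longrightarrow> norm (y0 + w *\<^sub>C y1) \<le> 1) \<Longrightarrow> norm y1 > \<kappa> * \<tau> / 4 \<Longrightarrow> norm y0 < 1 - \<delta>"
    using Y[unfolded C_uniformly_convex_def, rule_format, of "\<kappa> * \<tau> / 4"] \<kappa> \<tau> by auto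
  have "(\<lambda>f. T (\<lambda>t. g t * f t) - T f) \<in> ops_bounded_by M \<tau>"
    if T: "T \<in> ops_bounded_by M 1" and g: "g \<in> ess_bdd M" "AE t in M. cmod (g t) \<le> 1"
      and mid: "norm (T (\<lambda>t. (1 + g t) / 2)) > 1 - \<delta>"
    for M :: "'a measure" and T :: "('a \<Rightarrow> complex) \<Rightarrow> 'b" and g
  proof (rule ops_bounded_byI)
    fix f assume f: "f \<in> ess_bdd M" "AE t in M. cmod (f t) \<le> 1"
    note [measurable] = ess_bdd_measurable[OF g(1)] ess_bdd_measurable[OF f(1)]
    define d where "d t = g t * f t - f t" for t
    have d_bdd: "d \<in> ess_bdd M"
      unfolding d_def using ess_bdd_add[OF ess_bdd_mult[OF g(1) f(1)] ess_bdd_scale[OF f(1), of "- 1"]]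
      by simp
    define E where "E t \<longleftrightarrow> cmod (g t - 1) > \<tau> / 2" for t
    have [measurable]: "Measurable.pred M E" unfolding E_def by measurable
    define k where "k t = (if E t then d t else 0)" for t
    define r where "r t = (if \<not> E t then d t else 0)" for t
    have k: "k \<in> ess_bdd M" unfolding k_def by (rule ess_bdd_if[OF d_bdd]) measurable
    have r: "r \<in> ess_bdd M" unfolding r_def by (rule ess_bdd_if[OF d_bdd]) measurable
    have half: "(\<lambda>t. (1 + g t) / 2) \<in> ess_bdd M"
      using ess_bdd_scale[OF ess_bdd_add[OF ess_bdd_const[of 1] g(1)], of "1 / 2"] by simp
    have d_eq: "cmod (d t) = cmod (g t - 1) * cmod (f t)" for t
      unfolding d_def by (simp add: norm_mult[symmetric] algebra_simps)
    have r_le: "AE t in M. cmod (r t) \<le> \<tau> / 2"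
      using f(2)
    proof eventually_elim
      case (elim t)
      have "\<not> E t \<Longrightarrow> cmod (g t - 1) * cmod (f t) \<le> \<tau> / 2 * 1"
        using elim \<tau> by (intro mult_mono) (auto simp: E_def)
      then show ?case using \<tau> by (auto simp: r_def d_eq)
    qed
    \<comment> \<open>As \<open>k\<close> lives where \<open>g\<close> is far from 1, the midpoint leaves room for a multiple of it.\<close>
    have small: "norm (T (\<lambda>t. of_real (\<kappa> / 2) * k t)) \<le> \<kappa> * \<tau> / 4"
    proof (rule ccontr)
      assume "\<not> ?thesis"
      then have big: "norm (T (\<lambda>t. of_real (\<kappa> / 2) * k t)) > \<kappa> * \<tau> / 4" by simp
      have "norm (T (\<lambda>t. (1 + g t) / 2) + w *\<^sub>C T (\<lambda>t. of_real (\<kappa> / 2) * k t)) \<le> 1"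
        if w: "cmod w = 1" for w
      proof -
        have eq: "T (\<lambda>t. (1 + g t) / 2) + w *\<^sub>C T (\<lambda>t. of_real (\<kappa> / 2) * k t) =
            T (\<lambda>t. (1 + g t) / 2 + w * (of_real (\<kappa> / 2) * k t))"
          using ops_add[OF T half ess_bdd_scale[OF ess_bdd_scale[OF k]]]
            ops_scale[OF T ess_bdd_scale[OF k]] by metis
        have "AE t in M. cmod ((1 + g t) / 2 + w * (of_real (\<kappa> / 2) * k t)) \<le> 1"
          using g(2) f(2)
        proof eventually_elim
          case (elim t)
          show ?case
          proof (cases "E t")
            case True
            have mid: "cmod ((1 + g t) / 2) \<le> 1 - \<kappa>"
              unfolding \<kappa>_def using True elim \<tau> by (intro midpoint_in_disc) (auto simp: E_def)
            have "cmod (g t - 1) * cmod (f t) \<le> 2 * 1"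
              using elim norm_triangle_ineq4[of "g t" 1] by (intro mult_mono) auto
            then have "cmod (k t) \<le> 2" using True by (simp add: k_def d_eq)
            then have "cmod (w * (of_real (\<kappa> / 2) * k t)) \<le> \<kappa>"
              using w \<kappa> by (simp add: norm_mult)
            then show ?thesis using mid norm_triangle_ineq[of "(1 + g t) / 2"] by (smt (verit))
          next
            case False
            have "cmod (1 + g t) \<le> 2" using elim norm_triangle_ineq[of 1 "g t"] by simp
            then show ?thesis using False by (simp add: k_def norm_divide)
          qed
        qed
        then show ?thesis
          unfolding eq
          using ops_bound[OF T ess_bdd_add[OF half ess_bdd_scale[OF ess_bdd_scale[OF k]]] zero_le_one]
          by fastforce
      qed
      from convex[OF this big] mid show False by simp
    qed
    have "norm (T k) \<le> \<tau> / 2"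
      using small \<kappa> unfolding ops_scale[OF T k] by (simp add: norm_scaleC field_simps)
    moreover have "norm (T r) \<le> \<tau> / 2" using ops_bound[OF T r _ r_le] \<tau> by simp
    moreover have "T (\<lambda>t. g t * f t) - T f = T k + T r"
    proof -
      have "T (\<lambda>t. g t * f t) - T f = T d"
        unfolding d_def using ops_diff[OF T ess_bdd_mult[OF g(1) f(1)] f(1)] by simp
      also have "d = (\<lambda>t. k t + r t)" by (auto simp: k_def r_def)
      finally show ?thesis using ops_add[OF T k r] by simp
    qed
    ultimately show "norm (T (\<lambda>t. g t * f t) - T f) \<le> \<tau>"
      using norm_triangle_ineq[of "T k" "T r"] by simp
  next
    note D = ops_minus[OF ops_multiply[OF T g] T]
    fix f h assume "f \<in> ess_bdd M" "h \<in> ess_bdd M"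
    then show "T (\<lambda>t. g t * (f t + h t)) - T (\<lambda>t. f t + h t) =
        (T (\<lambda>t. g t * f t) - T f) + (T (\<lambda>t. g t * h t) - T h)"
      by (rule ops_add[OF D])
  next
    note D = ops_minus[OF ops_multiply[OF T g] T]
    fix a f assume "f \<in> ess_bdd M"
    then show "T (\<lambda>t. g t * (a * f t)) - T (\<lambda>t. a * f t) = a *\<^sub>C (T (\<lambda>t. g t * f t) - T f)"
      by (rule ops_scale[OF D])
  qed
  then show ?thesis using \<delta> by blast
qed

section \<open>Operators attaining their norm at the constant function 1\<close>

text \<open>
  One step of the iteration: \<open>\<eta>\<close> depends on \<open>\<epsilon>\<close> alone, whereas the new defect \<open>\<eta>'\<close> is arbitrary.
  The new operator is \<open>f \<mapsto> P (g f)\<close>, normalised, where \<open>P = T + \<rho> F(T \<cdot>) T 1\<close> almost attains its norm at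
  \<open>g\<close>.
\<close>

lemma improve_norm_at_one:
  assumes Y: "C_uniformly_convex TYPE('b::complex_banach)" and \<epsilon>: "\<epsilon> > 0"
  shows "\<exists>\<eta>>0. \<forall>M :: 'a measure. \<forall>T \<in> (ops_bounded_by M 1 :: (('a \<Rightarrow> complex) \<Rightarrow> 'b) set).
    norm (T (\<lambda>_. 1)) > 1 - \<eta> \<longrightarrow> (\<forall>\<eta>'>0. \<exists>T'\<in>ops_bounded_by M 1.
      norm (T' (\<lambda>_. 1)) > 1 - \<eta>' \<and> (\<lambda>f. T' f - T f) \<in> ops_bounded_by M \<epsilon>)"
proof -
  \<comment> \<open>The new operator differs from \<open>T\<close> by at most \<open>\<rho>\<close> for each of the normalisation, the multiplier
    and the rank one perturbation.\<close>
  define \<rho> where "\<rho> = min \<epsilon> 1 / 4"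
  have \<rho>: "\<rho> > 0" "\<rho> \<le> 1 / 4" "3 * \<rho> \<le> \<epsilon>" using \<epsilon> by (auto simp: \<rho>_def)
  obtain \<gamma> where \<gamma>: "\<gamma> > 0" and near: "\<And>(M :: 'a measure) (T :: ('a \<Rightarrow> complex) \<Rightarrow> 'b) g.
      T \<in> ops_bounded_by M 1 \<Longrightarrow> g \<in> ess_bdd M \<Longrightarrow> AE t in M. cmod (g t) \<le> 1 \<Longrightarrow>
      norm (T (\<lambda>t. (1 + g t) / 2)) > 1 - \<gamma> \<Longrightarrow>
      (\<lambda>f. T (\<lambda>t. g t * f t) - T f) \<in> ops_bounded_by M \<rho>"
    using multiplier_near_identity[OF Y \<rho>(1), where ?'a = 'a] by blast
  \<comment> \<open>The functional will be attained up to \<open>8 \<eta> / \<rho>\<close>, which has to be at most \<open>\<gamma>\<close>.\<close>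
  define \<eta> where "\<eta> = min (\<rho> * \<gamma> / 8) \<rho>"
  have \<eta>: "\<eta> > 0" "\<eta> \<le> \<rho>" "8 * \<eta> \<le> \<rho> * \<gamma>" using \<rho> \<gamma> by (auto simp: \<eta>_def)
  have "\<exists>T'\<in>ops_bounded_by M 1.
      norm (T' (\<lambda>_. 1)) > 1 - \<eta>' \<and> (\<lambda>f. T' f - T f) \<in> ops_bounded_by M \<epsilon>"
    if T: "T \<in> ops_bounded_by M 1" and T1: "norm (T (\<lambda>_. 1)) > 1 - \<eta>" and \<eta>': "\<eta>' > 0"
    for M :: "'a measure" and T :: "('a \<Rightarrow> complex) \<Rightarrow> 'b" and \<eta>'
  proof -
    define v where "v = T (\<lambda>_. 1)"
    define a where "a = norm v"
    have a: "a \<le> 1" "a > 1 - \<eta>" "a > 0"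
      using ops_bound[OF T, of "\<lambda>_. 1" 1] T1 \<eta> \<rho> by (auto simp: a_def v_def)
    obtain F where F: "\<And>u w. F (u + w) = F u + F w" "\<And>c u. F (c *\<^sub>C u) = c * F u"
        "\<And>u. cmod (F u) \<le> norm u" and Fv: "F v = of_real a"
      using norming_functional[of v] unfolding a_def by blast
    define P where "P f = T f + of_real \<rho> *\<^sub>C (F (T f) *\<^sub>C v)" for f
    have R: "(\<lambda>f. F (T f) *\<^sub>C v) \<in> ops_bounded_by M a"
      using ops_rank_one[OF T F, of v] by (simp add: a_def)
    have P: "P \<in> ops_bounded_by M (1 + \<rho> * a)"
      using ops_plus[OF T ops_scaleC[OF R, of "of_real \<rho>"]] \<rho> unfolding P_def[abs_def] by simp
    have P1: "norm (P (\<lambda>_. 1)) = (1 + \<rho> * a) * a"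
    proof -
      have "P (\<lambda>_. 1) = of_real (1 + \<rho> * a) *\<^sub>C v"
        unfolding P_def using Fv by (simp add: v_def[symmetric] scaleC_scaleC scaleC_add_left scaleC_one)
      then show ?thesis using \<rho> a by (simp only: norm_scaleC norm_of_real a_def[symmetric]) simp
    qed
    define B where "B = {f \<in> ess_bdd M. AE t in M. cmod (f t) \<le> 1}"
    define N where "N = (SUP f\<in>B. norm (P f))"
    have one: "(\<lambda>_. 1) \<in> B" unfolding B_def by simp
    have PB: "norm (P f) \<le> 1 + \<rho> * a" if "f \<in> B" for f
      using ops_bound[OF P, of f 1] that unfolding B_def by simp
    then have bdd: "bdd_above ((\<lambda>f. norm (P f)) ` B)" by (rule bdd_aboveI2)
    have PN: "norm (P f) \<le> N" if "f \<in> B" for f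
      unfolding N_def by (rule cSUP_upper[OF that bdd])
    have N_upper: "N \<le> 1 + \<rho> * a" unfolding N_def using one PB by (intro cSUP_least) auto
    have N_lower: "(1 + \<rho> * a) * a \<le> N" using PN[OF one] P1 by simp
    have a_le: "a \<le> (1 + \<rho> * a) * a" using \<rho> a by (simp add: algebra_simps)
    have N: "N > 0" using a_le N_lower a by linarith
    define \<nu> where "\<nu> = min \<eta>' \<eta>"
    have \<nu>: "\<nu> > 0" "\<nu> \<le> \<eta>'" "\<nu> \<le> \<eta>" using \<eta> \<eta>' by (auto simp: \<nu>_def)
    have "\<exists>g\<in>B. N * (1 - \<nu>) < norm (P g)"
    proof -
      have "N * (1 - \<nu>) < N" using N \<nu> by simp
      then show ?thesis using less_cSUP_iff[OF _ bdd] one unfolding N_def by blast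
    qed
    then obtain g\<^sub>0 where g\<^sub>0: "g\<^sub>0 \<in> B" "N * (1 - \<nu>) < norm (P g\<^sub>0)" by blast
    define b where "b = cmod (F (T g\<^sub>0))"
    obtain \<theta> where \<theta>: "cmod \<theta> = 1" "\<theta> * F (T g\<^sub>0) = of_real b"
      unfolding b_def using rotation_to_modulus by blast
    define g where "g t = \<theta> * g\<^sub>0 t" for t
    have g: "g \<in> ess_bdd M" "AE t in M. cmod (g t) \<le> 1"
      using g\<^sub>0(1) \<theta> unfolding B_def g_def by (auto simp: norm_mult intro: ess_bdd_scale)
    have "P g = \<theta> *\<^sub>C P g\<^sub>0"
      using ops_scale[OF P, of g\<^sub>0] g\<^sub>0(1) unfolding g_def B_def by simp
    then have Pg: "N * (1 - \<nu>) < norm (P g)" using g\<^sub>0(2) \<theta> by (simp add: norm_scaleC)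
    have FTg: "F (T g) = of_real b"
      using ops_scale[OF T, of g\<^sub>0 \<theta>] g\<^sub>0(1) \<theta> F(2) unfolding g_def B_def by simp
    have "norm (T g) \<le> 1" using ops_bound[OF T g(1) _ g(2)] by simp
    have "norm (P g) \<le> norm (T g) + \<rho> * (b * a)"
    proof -
      have "norm (of_real \<rho> *\<^sub>C (of_real b *\<^sub>C v)) = \<rho> * (b * a)"
        using \<rho> by (simp add: norm_scaleC norm_mult a_def b_def)
      then show ?thesis
        unfolding P_def FTg using norm_triangle_ineq[of "T g" "of_real \<rho> *\<^sub>C (of_real b *\<^sub>C v)"] by simp
    qed
    with \<open>norm (T g) \<le> 1\<close> have Pg_upper: "norm (P g) \<le> 1 + \<rho> * (b * a)" by simp
    \<comment> \<open>Almost attaining the norm of the perturbed operator forces \<open>F (T g)\<close> to be close to 1.\<close>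
    have "b \<le> 1" using F(3)[of "T g"] \<open>norm (T g) \<le> 1\<close> unfolding FTg by (simp add: b_def)
    have "1 - b < 8 * \<eta> / \<rho>"
    proof -
      have a2: "(1 - \<eta>) * (1 - \<eta>) \<le> a * (1 - \<nu>)"
        using a \<eta> \<nu> \<rho> by (intro mult_mono) auto
      have "(1 + \<rho> * a) * (1 - 2 * \<eta>) \<le> (1 + \<rho> * a) * ((1 - \<eta>) * (1 - \<eta>))"
        using \<rho> a by (intro mult_left_mono) (auto simp: algebra_simps)
      also have "\<dots> \<le> (1 + \<rho> * a) * (a * (1 - \<nu>))"
        using \<rho> a by (intro mult_left_mono[OF a2]) auto
      also have "\<dots> \<le> N * (1 - \<nu>)"
        using mult_right_mono[OF N_lower, of "1 - \<nu>"] \<nu> \<eta> \<rho> by (simp add: mult.assoc)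
      also have "\<dots> < 1 + \<rho> * (b * a)" using Pg Pg_upper by simp
      finally have "\<rho> * a * (1 - b) < 2 * \<eta> * (1 + \<rho> * a)" by (simp add: algebra_simps)
      also have "\<dots> \<le> 2 * \<eta> * 2"
        using \<eta> \<rho> a mult_mono[of \<rho> 1 a 1] by (intro mult_left_mono) auto
      finally have "\<rho> * (a * (1 - b)) < 4 * \<eta>" by (simp add: mult.assoc)
      moreover have "1 / 2 * (1 - b) \<le> a * (1 - b)"
        using \<open>b \<le> 1\<close> a \<eta> \<rho> by (intro mult_right_mono) auto
      then have "\<rho> * (1 / 2 * (1 - b)) \<le> \<rho> * (a * (1 - b))" using \<rho> by (intro mult_left_mono) auto
      ultimately have "\<rho> * (1 / 2 * (1 - b)) < 4 * \<eta>" by linarith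
      then show ?thesis using \<rho> by (simp add: field_simps)
    qed
    moreover have "8 * \<eta> / \<rho> \<le> \<gamma>" using \<eta>(3) \<rho> by (simp add: field_simps)
    moreover have "1 - a < \<gamma>"
    proof -
      have "\<rho> * \<gamma> \<le> 1 * \<gamma>" using \<rho> \<gamma> by (intro mult_right_mono) auto
      then show ?thesis using a(2) \<eta> by linarith
    qed
    ultimately have ab: "(a + b) / 2 > 1 - \<gamma>" by simp
    have "F (T (\<lambda>t. (1 + g t) / 2)) = of_real ((a + b) / 2)"
    proof -
      have "T (\<lambda>t. (1 / 2) * (1 + g t)) = (1 / 2) *\<^sub>C T (\<lambda>t. 1 + g t)"
        by (rule ops_scale[OF T ess_bdd_add[OF ess_bdd_const g(1)]])
      also have "T (\<lambda>t. 1 + g t) = v + T g"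
        unfolding v_def by (rule ops_add[OF T ess_bdd_const g(1)])
      finally have "T (\<lambda>t. (1 / 2) * (1 + g t)) = (1 / 2) *\<^sub>C (v + T g)" .
      then show ?thesis using F Fv FTg by simp
    qed
    then have "cmod (F (T (\<lambda>t. (1 + g t) / 2))) > 1 - \<gamma>" using ab by (simp only: norm_of_real)
    then have "norm (T (\<lambda>t. (1 + g t) / 2)) > 1 - \<gamma>" using F(3) by (rule less_le_trans)
    then have close: "(\<lambda>f. T (\<lambda>t. g t * f t) - T f) \<in> ops_bounded_by M \<rho>"
      by (rule near[OF T g])
    define Q where "Q f = P (\<lambda>t. g t * f t)" for f
    define T' where "T' f = of_real (1 / N) *\<^sub>C Q f" for f
    have Q: "Q \<in> ops_bounded_by M (1 + \<rho> * a)"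
      unfolding Q_def[abs_def] by (rule ops_multiply[OF P g])
    have QN: "Q \<in> ops_bounded_by M N"
    proof (rule ops_bounded_byI)
      fix f assume f: "f \<in> ess_bdd M" "AE t in M. cmod (f t) \<le> 1"
      have "AE t in M. cmod (g t * f t) \<le> 1"
        using g(2) f(2) by eventually_elim (simp add: norm_mult mult_le_one)
      then show "norm (Q f) \<le> N"
        unfolding Q_def using ess_bdd_mult[OF g(1) f(1)] by (intro PN) (simp add: B_def)
    qed (simp_all add: ops_add[OF Q] ops_scale[OF Q])
    have T'_ops: "T' \<in> ops_bounded_by M 1"
      using ops_scaleC[OF QN, of "of_real (1 / N)"] N unfolding T'_def[abs_def]
      by (simp add: norm_divide)
    have T'1: "norm (T' (\<lambda>_. 1)) > 1 - \<eta>'"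
    proof -
      have "N * (1 - \<eta>') \<le> N * (1 - \<nu>)" using N \<nu> by simp
      then have "N * (1 - \<eta>') < norm (P g)" using Pg by linarith
      then show ?thesis
        using N unfolding T'_def Q_def by (simp add: norm_scaleC norm_divide field_simps)
    qed
    have "\<rho> * a \<le> \<rho>" using mult_left_mono[OF a(1), of \<rho>] \<rho> by simp
    then have abs_N: "\<bar>1 - N\<bar> \<le> \<rho>"
      using N_upper N_lower a_le a(2) \<eta>(2) by linarith
    have "(\<lambda>f. T' f - T f) \<in> ops_bounded_by M \<epsilon>"
    proof (rule ops_bounded_byI)
      fix f assume f: "f \<in> ess_bdd M" "AE t in M. cmod (f t) \<le> 1"
      have gf: "g\<in>ess_bdd M" "(\<lambda>t. g t * f t) \<in> ess_bdd M" using g f by (auto intro: ess_bdd_mult)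
      have gf1: "AE t in M. cmod (g t * f t) \<le> 1"
        using g(2) f(2) by eventually_elim (simp add: norm_mult mult_le_one)
      have Q_T': "Q f = of_real N *\<^sub>C T' f" using N by (simp add: T'_def scaleC_scaleC scaleC_one)
      have "T' f - T f = of_real (1 - N) *\<^sub>C T' f + ((T (\<lambda>t. g t * f t) - T f)
          + of_real \<rho> *\<^sub>C (F (T (\<lambda>t. g t * f t)) *\<^sub>C v))"
      proof -
        have "of_real (1 - N) *\<^sub>C T' f = T' f - Q f"
          unfolding Q_T' by (simp add: complex_vector.scale_left_diff_distrib scaleC_one)
        then show ?thesis by (simp add: Q_def P_def)
      qed
      moreover have "norm (of_real (1 - N) *\<^sub>C T' f) \<le> \<rho> * 1"
        unfolding norm_scaleC norm_of_real
        using abs_N ops_bound[OF T'_ops f(1) _ f(2)] by (intro mult_mono) auto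
      moreover have "norm (T (\<lambda>t. g t * f t) - T f) \<le> \<rho>"
        using ops_bound[OF close f(1) _ f(2)] by simp
      moreover have "norm (of_real \<rho> *\<^sub>C (F (T (\<lambda>t. g t * f t)) *\<^sub>C v)) \<le> \<rho> * 1"
        unfolding norm_scaleC[of "of_real \<rho>"] norm_of_real
        using ops_bound[OF R gf(2) _ gf1] a(1) \<rho> by (intro mult_mono) auto
      moreover have "norm (x + (y + z)) \<le> norm x + norm y + norm z" for x y z :: 'b
        using norm_triangle_ineq[of x "y + z"] norm_triangle_ineq[of y z] by linarith
      ultimately show "norm (T' f - T f) \<le> \<epsilon>"
        using \<rho>(3) by (simp only: mult_1_right) (rule order_trans, assumption, linarith)
    next
      fix f h assume "f \<in> ess_bdd M" "h \<in> ess_bdd M"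
      then show "T' (\<lambda>t. f t + h t) - T (\<lambda>t. f t + h t) = (T' f - T f) + (T' h - T h)"
        by (rule ops_add[OF ops_minus[OF T'_ops T]])
    next
      fix c f assume "f \<in> ess_bdd M"
      then show "T' (\<lambda>t. c * f t) - T (\<lambda>t. c * f t) = c *\<^sub>C (T' f - T f)"
        by (rule ops_scale[OF ops_minus[OF T'_ops T]])
    qed
    then show ?thesis using T'_ops T'1 by blast
  qed
  then show ?thesis using \<eta>(1) by blast
qed

lemma tendsto_scaleC:
  fixes f :: "'s \<Rightarrow> 'b::complex_banach"
  assumes "(c \<longlongrightarrow> a) F" "(f \<longlongrightarrow> v) F"
  shows "((\<lambda>x. c x *\<^sub>C f x) \<longlongrightarrow> a *\<^sub>C v) F"
proof -
  have "((\<lambda>x. cmod (c x) * norm (f x - v) + cmod (c x - a) * norm v) \<longlongrightarrow>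
      cmod a * norm (v - v) + cmod (a - a) * norm v) F"
    by (intro tendsto_intros assms)
  then have lim: "((\<lambda>x. cmod (c x) * norm (f x - v) + cmod (c x - a) * norm v) \<longlongrightarrow> 0) F"
    by simp
  have "norm (c x *\<^sub>C f x - a *\<^sub>C v) \<le> cmod (c x) * norm (f x - v) + cmod (c x - a) * norm v" for x
  proof -
    have "c x *\<^sub>C f x - a *\<^sub>C v = c x *\<^sub>C (f x - v) + (c x - a) *\<^sub>C v"
      by (simp add: complex_vector.scale_left_diff_distrib complex_vector.scale_right_diff_distrib)
    then show ?thesis
      using norm_triangle_ineq[of "c x *\<^sub>C (f x - v)" "(c x - a) *\<^sub>C v"] by (simp add: norm_scaleC)
  qed
  then have "((\<lambda>x. c x *\<^sub>C f x - a *\<^sub>C v) \<longlongrightarrow> 0) F"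
    by (intro Lim_null_comparison[OF always_eventually lim] allI)
  then show ?thesis using Lim_null by blast
qed

text \<open>
  The steps are of size \<open>\<epsilon> / 2, \<epsilon> / 4, \<dots>\<close>, and each reaches the defect required by the next one. The
  bound \<open>e n\<close> on the defect makes it tend to 0.
\<close>

lemma attain_norm_at_one:
  assumes Y: "C_uniformly_convex TYPE('b::complex_banach)" and \<epsilon>: "\<epsilon> > 0"
  shows "\<exists>\<eta>>0. \<forall>M :: 'a measure. \<forall>T \<in> (ops_bounded_by M 1 :: (('a \<Rightarrow> complex) \<Rightarrow> 'b) set).
    norm (T (\<lambda>_. 1)) > 1 - \<eta> \<longrightarrow> (\<exists>S\<in>ops_bounded_by M 1.
      norm (S (\<lambda>_. 1)) = 1 \<and> (\<lambda>f. S f - T f) \<in> ops_bounded_by M \<epsilon>)"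
proof -
  define e where "e n = \<epsilon> * (1 / 2) ^ Suc n" for n
  have e: "e n > 0" for n using \<epsilon> by (simp add: e_def)
  have "\<forall>n. \<exists>\<eta>>0. \<forall>M :: 'a measure. \<forall>T \<in> (ops_bounded_by M 1 :: (('a \<Rightarrow> complex) \<Rightarrow> 'b) set).
    norm (T (\<lambda>_. 1)) > 1 - \<eta> \<longrightarrow> (\<forall>\<eta>'>0. \<exists>T'\<in>ops_bounded_by M 1.
      norm (T' (\<lambda>_. 1)) > 1 - \<eta>' \<and> (\<lambda>f. T' f - T f) \<in> ops_bounded_by M (e n))"
    by (intro allI improve_norm_at_one[OF Y e])
  from choice[OF this] obtain H where H: "\<And>n. H n > 0"
    and improve: "\<And>n (M :: 'a measure) (T :: ('a \<Rightarrow> complex) \<Rightarrow> 'b) \<eta>'. T \<in> ops_bounded_by M 1 \<Longrightarrow>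
      norm (T (\<lambda>_. 1)) > 1 - H n \<Longrightarrow> \<eta>' > 0 \<Longrightarrow> \<exists>T'\<in>ops_bounded_by M 1.
      norm (T' (\<lambda>_. 1)) > 1 - \<eta>' \<and> (\<lambda>f. T' f - T f) \<in> ops_bounded_by M (e n)"
    by blast
  have "\<exists>S\<in>ops_bounded_by M 1. norm (S (\<lambda>_. 1)) = 1 \<and> (\<lambda>f. S f - T f) \<in> ops_bounded_by M \<epsilon>"
    if T: "T \<in> ops_bounded_by M 1" and T1: "norm (T (\<lambda>_. 1)) > 1 - min (H 0) (e 0)"
    for M :: "'a measure" and T :: "('a \<Rightarrow> complex) \<Rightarrow> 'b"
  proof -
    let ?P = "\<lambda>n S. S \<in> ops_bounded_by M 1 \<and> norm (S (\<lambda>_. 1)) > 1 - min (H n) (e n) \<and>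
      (n = 0 \<longrightarrow> S = T)"
    let ?Q = "\<lambda>n S S'. (\<lambda>f. S' f - S f) \<in> ops_bounded_by M (e n)"
    have "\<exists>V. \<forall>n. ?P n (V n) \<and> ?Q n (V n) (V (Suc n))"
    proof (rule dependent_nat_choice)
      show "\<exists>S. ?P 0 S" using T T1 by blast
      show "\<exists>S'. ?P (Suc n) S' \<and> ?Q n S S'" if S: "?P n S" for S n
      proof -
        have "norm (S (\<lambda>_. 1)) > 1 - H n" using S by linarith
        moreover have "min (H (Suc n)) (e (Suc n)) > 0" using H e by simp
        ultimately obtain S' where "S' \<in> ops_bounded_by M 1"
            "norm (S' (\<lambda>_. 1)) > 1 - min (H (Suc n)) (e (Suc n))"
            "(\<lambda>f. S' f - S f) \<in> ops_bounded_by M (e n)"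
          using improve[of S M n "min (H (Suc n)) (e (Suc n))"] S by blast
        then show ?thesis by blast
      qed
    qed
    then obtain V where PQ: "\<And>n. ?P n (V n)" "\<And>n. ?Q n (V n) (V (Suc n))" by blast
    then have V: "V n \<in> ops_bounded_by M 1" "V 0 = T"
      and step: "(\<lambda>f. V (Suc n) f - V n f) \<in> ops_bounded_by M (e n)" for n by auto
    have V1: "norm (V n (\<lambda>_. 1)) > 1 - e n" for n using PQ(1)[of n] by linarith
    define S where "S f = T f + (\<Sum>n. V (Suc n) f - V n f)" for f
    have geometric: "(\<lambda>n. e n * C) sums (\<epsilon> * C)" for C
    proof -
      have "(\<lambda>n. (\<epsilon> * C) * (1 / 2) ^ Suc n) sums ((\<epsilon> * C) * 1)"
        by (rule sums_mult[OF power_half_series])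
      then show ?thesis by (simp add: e_def mult_ac)
    qed
    have limit: "(\<lambda>n. V n f) \<longlonglongrightarrow> S f"
      and dist: "\<And>C. C \<ge> 0 \<Longrightarrow> AE t in M. cmod (f t) \<le> C \<Longrightarrow> norm (S f - T f) \<le> \<epsilon> * C"
      if f: "f \<in> ess_bdd M" for f
    proof -
      have le: "norm (V (Suc n) f - V n f) \<le> e n * C"
        if "C \<ge> 0" "AE t in M. cmod (f t) \<le> C" for C n
        by (rule ops_bound[OF step f that])
      obtain C where C: "C > 0" "AE t in M. cmod (f t) \<le> C" using ess_bdd_bound[OF f] .
      have "summable (\<lambda>n. norm (V (Suc n) f - V n f))"
      proof (rule summable_comparison_test'[OF sums_summable[OF geometric[of C]]])
        show "norm (norm (V (Suc n) f - V n f)) \<le> e n * C" if "n \<ge> 0" for n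
          using le[OF less_imp_le[OF C(1)] C(2), of n] by simp
      qed
      then have "summable (\<lambda>n. V (Suc n) f - V n f)" by (rule summable_norm_cancel)
      then have "(\<lambda>n. \<Sum>i<n. V (Suc i) f - V i f) \<longlonglongrightarrow> (\<Sum>n. V (Suc n) f - V n f)"
        by (rule summable_LIMSEQ)
      then have "(\<lambda>n. V n f - V 0 f) \<longlonglongrightarrow> (\<Sum>n. V (Suc n) f - V n f)"
        using sum_lessThan_telescope[of "\<lambda>n. V n f"] by simp
      then have "(\<lambda>n. T f + (V n f - V 0 f)) \<longlonglongrightarrow> S f"
        unfolding S_def by (intro tendsto_add tendsto_const)
      then show "(\<lambda>n. V n f) \<longlonglongrightarrow> S f" using V(2) by simp
      fix D assume D: "D \<ge> 0" "AE t in M. cmod (f t) \<le> D"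
      have "norm (\<Sum>n. V (Suc n) f - V n f) \<le> (\<Sum>n. e n * D)"
        using le[OF D] sums_summable[OF geometric] by (rule norm_suminf_le)
      then show "norm (S f - T f) \<le> \<epsilon> * D"
        unfolding S_def using sums_unique[OF geometric[of D]] by simp
    qed
    have S: "S \<in> ops_bounded_by M 1"
    proof (rule ops_bounded_byI)
      fix f g assume fg: "f \<in> ess_bdd M" "g \<in> ess_bdd M"
      have "(\<lambda>n. V n (\<lambda>t. f t + g t)) \<longlonglongrightarrow> S f + S g"
        unfolding ops_add[OF V(1) fg] by (intro tendsto_add limit fg)
      then show "S (\<lambda>t. f t + g t) = S f + S g"
        by (rule LIMSEQ_unique[OF limit[OF ess_bdd_add[OF fg]]])
    next
      fix c f assume f: "f \<in> ess_bdd M"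
      have "(\<lambda>n. V n (\<lambda>t. c * f t)) \<longlonglongrightarrow> c *\<^sub>C S f"
        unfolding ops_scale[OF V(1) f] by (intro tendsto_scaleC tendsto_const limit f)
      then show "S (\<lambda>t. c * f t) = c *\<^sub>C S f"
        by (rule LIMSEQ_unique[OF limit[OF ess_bdd_scale[OF f]]])
    next
      fix f assume f: "f \<in> ess_bdd M" "AE t in M. cmod (f t) \<le> 1"
      show "norm (S f) \<le> 1"
        using tendsto_norm[OF limit[OF f(1)]]
      proof (rule LIMSEQ_le_const2)
        show "\<exists>N. \<forall>n\<ge>N. norm (V n f) \<le> 1" using ops_bound[OF V(1) f(1) _ f(2)] by auto
      qed
    qed
    have "norm (S (\<lambda>_. 1)) \<ge> 1"
    proof -
      have "(\<lambda>n. 1 - e n * 1) \<longlonglongrightarrow> 1 - 0"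
        using summable_LIMSEQ_zero[OF sums_summable[OF geometric[of 1]]]
        by (intro tendsto_diff tendsto_const)
      moreover have "(\<lambda>n. norm (V n (\<lambda>_. 1))) \<longlonglongrightarrow> norm (S (\<lambda>_. 1))"
        by (intro tendsto_norm limit) simp
      ultimately have "1 - 0 \<le> norm (S (\<lambda>_. 1))"
        using V1 by (intro LIMSEQ_le) (auto intro: less_imp_le)
      then show ?thesis by simp
    qed
    moreover have "norm (S (\<lambda>_. 1)) \<le> 1" using ops_bound[OF S, of "\<lambda>_. 1" 1] by simp
    moreover have "(\<lambda>f. S f - T f) \<in> ops_bounded_by M \<epsilon>"
    proof (rule ops_bounded_byI)
      fix f assume "f \<in> ess_bdd M" "AE t in M. cmod (f t) \<le> 1"
      then show "norm (S f - T f) \<le> \<epsilon>" using dist[of f 1] by simp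
    qed (rule ops_add[OF ops_minus[OF S T]] ops_scale[OF ops_minus[OF S T]]; assumption)+
    ultimately show ?thesis using S by force
  qed
  moreover have "min (H 0) (e 0) > 0" using H e by simp
  ultimately show ?thesis by blast
qed

text \<open>
  To an operator \<open>R\<close> attaining its norm at 1 the final perturbation adds a multiple of a functional
  norming \<open>R 1\<close>. A sequence that almost attains the norm of the sum must almost attain this
  functional, and then its members are, along a subsequence and after rotation, multipliers that
  change \<open>R\<close> less and less.
\<close>

theorem attain_strongly_at_one:
  assumes Y: "C_uniformly_convex TYPE('b::complex_banach)" and \<epsilon>: "\<epsilon> > 0"
  shows "\<exists>\<eta>>0. \<forall>M :: 'a measure. \<forall>T \<in> (ops_bounded_by M 1 :: (('a \<Rightarrow> complex) \<Rightarrow> 'b) set).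
    norm (T (\<lambda>_. 1)) > 1 - \<eta> \<longrightarrow> (\<exists>S\<in>ops_bounded_by M 1.
      norm (S (\<lambda>_. 1)) = 1 \<and> (\<lambda>f. S f - T f) \<in> ops_bounded_by M \<epsilon> \<and>
      (\<forall>f :: nat \<Rightarrow> 'a \<Rightarrow> complex. (\<forall>n. f n \<in> ess_bdd M \<and> (AE t in M. cmod (f n t) \<le> 1)) \<and>
        (\<lambda>n. norm (S (f n))) \<longlonglongrightarrow> 1 \<longrightarrow>
        (\<exists>\<sigma> \<theta>. strict_mono \<sigma> \<and> cmod \<theta> = 1 \<and> (\<lambda>n. S (f (\<sigma> n))) \<longlonglongrightarrow> \<theta> *\<^sub>C S (\<lambda>_. 1))))"
proof -
  define \<rho> where "\<rho> = \<epsilon> / 4"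
  have \<rho>: "\<rho> > 0" using \<epsilon> by (simp add: \<rho>_def)
  obtain \<eta> where \<eta>: "\<eta> > 0" and attain: "\<And>(M :: 'a measure) (T :: ('a \<Rightarrow> complex) \<Rightarrow> 'b).
      T \<in> ops_bounded_by M 1 \<Longrightarrow> norm (T (\<lambda>_. 1)) > 1 - \<eta> \<Longrightarrow> \<exists>S\<in>ops_bounded_by M 1.
      norm (S (\<lambda>_. 1)) = 1 \<and> (\<lambda>f. S f - T f) \<in> ops_bounded_by M (\<epsilon> / 2)"
    using attain_norm_at_one[OF Y, of "\<epsilon> / 2"] \<epsilon> by auto
  have "\<exists>S\<in>ops_bounded_by M 1.
      norm (S (\<lambda>_. 1)) = 1 \<and> (\<lambda>f. S f - T f) \<in> ops_bounded_by M \<epsilon> \<and>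
      (\<forall>f :: nat \<Rightarrow> 'a \<Rightarrow> complex. (\<forall>n. f n \<in> ess_bdd M \<and> (AE t in M. cmod (f n t) \<le> 1)) \<and>
        (\<lambda>n. norm (S (f n))) \<longlonglongrightarrow> 1 \<longrightarrow>
        (\<exists>\<sigma> \<theta>. strict_mono \<sigma> \<and> cmod \<theta> = 1 \<and> (\<lambda>n. S (f (\<sigma> n))) \<longlonglongrightarrow> \<theta> *\<^sub>C S (\<lambda>_. 1)))"
    if T: "T \<in> ops_bounded_by M 1" and T1: "norm (T (\<lambda>_. 1)) > 1 - \<eta>"
    for M :: "'a measure" and T :: "('a \<Rightarrow> complex) \<Rightarrow> 'b"
  proof -
    obtain R where R: "R \<in> ops_bounded_by M 1" "norm (R (\<lambda>_. 1)) = 1"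
      and RT: "(\<lambda>f. R f - T f) \<in> ops_bounded_by M (\<epsilon> / 2)"
      using attain[OF T T1] by blast
    define v where "v = R (\<lambda>_. 1)"
    have v: "norm v = 1" using R by (simp add: v_def)
    obtain F where F: "\<And>u w. F (u + w) = F u + F w" "\<And>c u. F (c *\<^sub>C u) = c * F u"
        "\<And>u. cmod (F u) \<le> norm u" and Fv: "F v = 1"
      using norming_functional[of v] v by auto
    define P where "P f = of_real \<rho> *\<^sub>C (F (R f) *\<^sub>C v)" for f
    have P: "P \<in> ops_bounded_by M \<rho>"
      using ops_scaleC[OF ops_rank_one[OF R(1) F, of v], of "of_real \<rho>"] v \<rho>
      unfolding P_def[abs_def] by simp
    define S where "S f = of_real (1 / (1 + \<rho>)) *\<^sub>C (R f + P f)" for f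
    have S: "S \<in> ops_bounded_by M 1"
      using ops_scaleC[OF ops_plus[OF R(1) P], of "of_real (1 / (1 + \<rho>))"] \<rho>
      unfolding S_def[abs_def] by (simp add: norm_divide del: of_real_add)
    have RS: "R f + P f = of_real (1 + \<rho>) *\<^sub>C S f" for f
      using \<rho> by (simp add: S_def scaleC_scaleC scaleC_one del: of_real_add flip: of_real_mult)
    have S1: "S (\<lambda>_. 1) = v"
    proof -
      have "R (\<lambda>_. 1) + P (\<lambda>_. 1) = of_real (1 + \<rho>) *\<^sub>C v"
        unfolding P_def v_def[symmetric] Fv by (simp add: scaleC_one scaleC_add_left)
      then show ?thesis
        using \<rho> by (simp add: S_def scaleC_scaleC scaleC_one del: of_real_add flip: of_real_mult)
    qed
    have ST: "(\<lambda>f. S f - T f) \<in> ops_bounded_by M \<epsilon>"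
    proof (rule ops_bounded_byI)
      fix f assume f: "f \<in> ess_bdd M" "AE t in M. cmod (f t) \<le> 1"
      have eq: "S f - T f = (P f - of_real \<rho> *\<^sub>C S f) + (R f - T f)"
        using RS[of f] by (simp add: scaleC_add_left scaleC_one algebra_simps)
      have "norm (of_real \<rho> *\<^sub>C S f) \<le> \<rho>"
        using ops_bound[OF S f(1) _ f(2)] \<rho> by (simp add: norm_scaleC)
      moreover have "norm (P f) \<le> \<rho>" "norm (R f - T f) \<le> \<epsilon> / 2"
        using ops_bound[OF P f(1) _ f(2)] ops_bound[OF RT f(1) _ f(2)] by simp_all
      ultimately show "norm (S f - T f) \<le> \<epsilon>"
        unfolding eq
        using norm_triangle_ineq[of "P f - of_real \<rho> *\<^sub>C S f" "R f - T f"]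
          norm_triangle_ineq4[of "P f" "of_real \<rho> *\<^sub>C S f"] \<rho>_def by linarith
    qed (rule ops_add[OF ops_minus[OF S T]] ops_scale[OF ops_minus[OF S T]]; assumption)+
    have "\<exists>\<sigma> \<theta>. strict_mono \<sigma> \<and> cmod \<theta> = 1 \<and> (\<lambda>n. S (f (\<sigma> n))) \<longlonglongrightarrow> \<theta> *\<^sub>C v"
      if f: "\<And>n. f n \<in> ess_bdd M" "\<And>n. AE t in M. cmod (f n t) \<le> 1"
        and lim: "(\<lambda>n. norm (S (f n))) \<longlonglongrightarrow> 1" for f :: "nat \<Rightarrow> 'a \<Rightarrow> complex"
    proof -
      have Rf: "norm (R (f n)) \<le> 1" for n using ops_bound[OF R(1) f(1) _ f(2)] by simp
      then have FR: "cmod (F (R (f n))) \<le> 1" for n using F(3) order_trans by blast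
      have "(\<lambda>n. ((1 + \<rho>) * norm (S (f n)) - 1) / \<rho>) \<longlonglongrightarrow> ((1 + \<rho>) * 1 - 1) / \<rho>"
        using \<rho> by (intro tendsto_intros lim) auto
      moreover have "((1 + \<rho>) * 1 - 1) / \<rho> = 1" using \<rho> by simp
      moreover have "((1 + \<rho>) * norm (S (f n)) - 1) / \<rho> \<le> cmod (F (R (f n)))" for n
      proof -
        have "(1 + \<rho>) * norm (S (f n)) = norm (R (f n) + P (f n))"
          unfolding RS using \<rho> by (simp add: norm_scaleC del: of_real_add)
        also have "\<dots> \<le> 1 + \<rho> * cmod (F (R (f n)))"
          using norm_triangle_ineq[of "R (f n)" "P (f n)"] Rf[of n] \<rho> v
          by (simp add: P_def norm_scaleC norm_mult)
        finally show ?thesis using \<rho> by (simp add: field_simps)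
      qed
      ultimately have "(\<lambda>n. ((1 + \<rho>) * norm (S (f n)) - 1) / \<rho>) \<longlonglongrightarrow> 1"
        and lower: "eventually (\<lambda>n. ((1 + \<rho>) * norm (S (f n)) - 1) / \<rho> \<le> cmod (F (R (f n)))) sequentially"
        by simp_all
      moreover have "eventually (\<lambda>n. cmod (F (R (f n))) \<le> 1) sequentially" using FR by simp
      ultimately have modulus: "(\<lambda>n. cmod (F (R (f n)))) \<longlonglongrightarrow> 1"
        using tendsto_sandwich[OF lower _ _ tendsto_const] by blast
      have "seq_compact (cball (0 :: complex) 1)" by (simp add: compact_imp_seq_compact)
      moreover have "\<forall>n. F (R (f n)) \<in> cball 0 1" using FR by simp
      ultimately obtain \<theta> \<sigma> where \<sigma>: "strict_mono \<sigma>"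
          and \<theta>_lim: "((\<lambda>n. F (R (f n))) \<circ> \<sigma>) \<longlonglongrightarrow> \<theta>"
        by (rule seq_compactE)
      have "(\<lambda>n. cmod (F (R (f (\<sigma> n))))) \<longlonglongrightarrow> cmod \<theta>"
        using tendsto_norm[OF \<theta>_lim] by (simp add: o_def)
      moreover have "(\<lambda>n. cmod (F (R (f (\<sigma> n))))) \<longlonglongrightarrow> 1"
        using LIMSEQ_subseq_LIMSEQ[OF modulus \<sigma>] by (simp add: o_def)
      ultimately have \<theta>: "cmod \<theta> = 1" by (rule LIMSEQ_unique)
      have \<theta>_cnj: "\<theta> * cnj \<theta> = 1" using complex_norm_square[of \<theta>] \<theta> by simp
      define h where "h n t = cnj \<theta> * f (\<sigma> n) t" for n t
      have h: "h n \<in> ess_bdd M" "AE t in M. cmod (h n t) \<le> 1" for n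
        using f \<theta> unfolding h_def by (auto simp: norm_mult intro: ess_bdd_scale)
      have Rh: "R (h n) = cnj \<theta> *\<^sub>C R (f (\<sigma> n))" for n
        unfolding h_def by (rule ops_scale[OF R(1) f(1)])
      have mid: "F (R (\<lambda>t. (1 + h n t) / 2)) = (1 + cnj \<theta> * F (R (f (\<sigma> n)))) / 2" for n
      proof -
        have "R (\<lambda>t. (1 / 2) * (1 + h n t)) = (1 / 2) *\<^sub>C R (\<lambda>t. 1 + h n t)"
          by (rule ops_scale[OF R(1) ess_bdd_add[OF ess_bdd_const h(1)]])
        also have "R (\<lambda>t. 1 + h n t) = v + R (h n)"
          unfolding v_def by (rule ops_add[OF R(1) ess_bdd_const h(1)])
        finally show ?thesis using F(1,2) Fv Rh by simp
      qed
      have "(\<lambda>n. cmod ((1 + cnj \<theta> * F (R (f (\<sigma> n)))) / 2)) \<longlonglongrightarrow> cmod ((1 + cnj \<theta> * \<theta>) / 2)"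
        using \<theta>_lim unfolding o_def by (intro tendsto_intros) auto
      then have mid_lim: "(\<lambda>n. cmod ((1 + cnj \<theta> * F (R (f (\<sigma> n)))) / 2)) \<longlonglongrightarrow> 1"
        using \<theta>_cnj by (simp add: mult.commute)
      have "(\<lambda>n. R (h n)) \<longlonglongrightarrow> v"
      proof (rule LIMSEQ_I)
        fix r :: real assume r: "r > 0"
        obtain \<gamma> where \<gamma>: "\<gamma> > 0" and near: "\<And>(M :: 'a measure) (T :: ('a \<Rightarrow> complex) \<Rightarrow> 'b) g.
            T \<in> ops_bounded_by M 1 \<Longrightarrow> g \<in> ess_bdd M \<Longrightarrow> AE t in M. cmod (g t) \<le> 1 \<Longrightarrow>
            norm (T (\<lambda>t. (1 + g t) / 2)) > 1 - \<gamma> \<Longrightarrow>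
            (\<lambda>f. T (\<lambda>t. g t * f t) - T f) \<in> ops_bounded_by M (r / 2)"
          using multiplier_near_identity[OF Y, where ?'a = 'a and \<tau> = "r / 2"] r by auto
        have "eventually (\<lambda>n. cmod ((1 + cnj \<theta> * F (R (f (\<sigma> n)))) / 2) > 1 - \<gamma>) sequentially"
          using \<gamma> by (intro order_tendstoD[OF mid_lim]) auto
        then have "eventually (\<lambda>n. norm (R (h n) - v) < r) sequentially"
        proof eventually_elim
          case (elim n)
          have "norm (R (\<lambda>t. (1 + h n t) / 2)) > 1 - \<gamma>"
            using elim F(3)[of "R (\<lambda>t. (1 + h n t) / 2)"] unfolding mid by linarith
          then have "(\<lambda>f. R (\<lambda>t. h n t * f t) - R f) \<in> ops_bounded_by M (r / 2)"
            by (rule near[OF R(1) h])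
          from ops_bound[OF this, of "\<lambda>_. 1" 1] show ?case using r by (simp add: v_def)
        qed
        then show "\<exists>N. \<forall>n\<ge>N. norm (R (h n) - v) < r" by (simp add: eventually_sequentially)
      qed
      then have "(\<lambda>n. \<theta> *\<^sub>C R (h n)) \<longlonglongrightarrow> \<theta> *\<^sub>C v" by (intro tendsto_scaleC tendsto_const)
      then have R_lim: "(\<lambda>n. R (f (\<sigma> n))) \<longlonglongrightarrow> \<theta> *\<^sub>C v"
        unfolding Rh scaleC_scaleC \<theta>_cnj scaleC_one .
      have "(\<lambda>n. S (f (\<sigma> n))) \<longlonglongrightarrow>
          of_real (1 / (1 + \<rho>)) *\<^sub>C (\<theta> *\<^sub>C v + of_real \<rho> *\<^sub>C (\<theta> *\<^sub>C v))"
        unfolding S_def P_def using \<theta>_lim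
        by (intro tendsto_scaleC tendsto_add tendsto_const R_lim) (simp add: o_def)
      also have "of_real (1 / (1 + \<rho>)) *\<^sub>C (\<theta> *\<^sub>C v + of_real \<rho> *\<^sub>C (\<theta> *\<^sub>C v)) = \<theta> *\<^sub>C v"
      proof -
        have "\<theta> *\<^sub>C v + of_real \<rho> *\<^sub>C (\<theta> *\<^sub>C v) = of_real (1 + \<rho>) *\<^sub>C (\<theta> *\<^sub>C v)"
          by (simp add: scaleC_add_left scaleC_scaleC scaleC_one distrib_right)
        moreover have "complex_of_real (1 / (1 + \<rho>)) * of_real (1 + \<rho>) = 1"
          using \<rho> by (simp del: of_real_add flip: of_real_mult)
        ultimately show ?thesis by (metis scaleC_one scaleC_scaleC)
      qed
      finally show ?thesis using \<sigma> \<theta> by blast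
    qed
    then show ?thesis using S S1 ST v by (intro bexI[of _ S]) auto
  qed
  then show ?thesis using \<eta> by blast
qed

section \<open>Spaces represented by an order ideal of essentially bounded functions\<close>

text \<open>
  The map \<open>q\<close> sends a function to the vector it represents: it is the identity for sequence spaces
  and the passage to classes for \<open>L\<^sub>\<infinity>(\<mu>)\<close>. Closure under domination makes multiplication by
  essentially bounded functions available also in spaces without unit, such as \<open>c\<^sub>0\<close>.
\<close>

locale function_model =
  fixes M :: "'a measure" and V :: "('a \<Rightarrow> complex) set" and q :: "('a \<Rightarrow> complex) \<Rightarrow> 'x"
    and X :: "'x cnspace"
  assumes V_ess_bdd: "V \<subseteq> ess_bdd M"
    and V_zero: "(\<lambda>_. 0) \<in> V"
    and V_add: "f \<in> V \<Longrightarrow> g \<in> V \<Longrightarrow> (\<lambda>t. f t + g t) \<in> V"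
    and V_ideal: "f \<in> V \<Longrightarrow> g \<in> borel_measurable M \<Longrightarrow> AE t in M. cmod (g t) \<le> C * cmod (f t) \<Longrightarrow> g \<in> V"
    and vecs_eq: "vecs X = q ` V"
    and vadd_q: "f \<in> V \<Longrightarrow> g \<in> V \<Longrightarrow> vadd X (q f) (q g) = q (\<lambda>t. f t + g t)"
    and vscale_q: "f \<in> V \<Longrightarrow> vscale X a (q f) = q (\<lambda>t. a * f t)"
    and vnorm_q: "f \<in> V \<Longrightarrow> 0 \<le> C \<Longrightarrow> vnorm X (q f) \<le> C \<longleftrightarrow> (AE t in M. cmod (f t) \<le> C)"
    and vnorm_nonneg: "f \<in> V \<Longrightarrow> 0 \<le> vnorm X (q f)"
begin

lemma V_measurable: "f \<in> V \<Longrightarrow> f \<in> borel_measurable M"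
  using V_ess_bdd ess_bdd_measurable by blast

lemma V_scale: "f \<in> V \<Longrightarrow> (\<lambda>t. a * f t) \<in> V"
  by (rule V_ideal[where f = f and C = "cmod a"])
    (simp_all add: norm_mult V_measurable borel_measurable_times)

lemma vdiff_q: "f \<in> V \<Longrightarrow> g \<in> V \<Longrightarrow> vdiff X (q f) (q g) = q (\<lambda>t. f t - g t)"
  using vadd_q[OF _ V_scale[of g "- 1"], of f] by (simp add: vdiff_def vscale_q)

lemma V_diff: "f \<in> V \<Longrightarrow> g \<in> V \<Longrightarrow> (\<lambda>t. f t - g t) \<in> V"
  using V_add[OF _ V_scale[of g "- 1"], of f] by simp

lemma q_eqD:
  assumes f: "f \<in> V" and g: "g \<in> V" and eq: "q f = q g"
  shows "AE t in M. f t = g t"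
proof -
  have "q (\<lambda>t. f t - g t) = q (\<lambda>t. g t - g t)"
    using vdiff_q[OF f g] vdiff_q[OF g g] eq by simp
  moreover have "vnorm X (q (\<lambda>t. g t - g t)) \<le> 0"
    using vnorm_q[OF V_diff[OF g g], of 0] by simp
  ultimately have "AE t in M. cmod (f t - g t) \<le> 0"
    using vnorm_q[OF V_diff[OF f g], of 0] by simp
  then show ?thesis by eventually_elim simp
qed

definition rep :: "'x \<Rightarrow> 'a \<Rightarrow> complex" where
  "rep x = (SOME f. f \<in> V \<and> q f = x)"

lemma rep:
  assumes "x \<in> vecs X"
  shows "rep x \<in> V" "q (rep x) = x"
proof -
  have "\<exists>f. f \<in> V \<and> q f = x" using assms unfolding vecs_eq by blast
  from someI_ex[OF this] show "rep x \<in> V" "q (rep x) = x" by (simp_all add: rep_def)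
qed

lemma vecs_cases:
  assumes "x \<in> vecs X"
  obtains f where "f \<in> V" "x = q f"
  using assms unfolding vecs_eq by blast

lemma q_vecs: "f \<in> V \<Longrightarrow> q f \<in> vecs X"
  unfolding vecs_eq by blast

lemma unit_ball_q: "f \<in> V \<Longrightarrow> q f \<in> unit_ball X \<longleftrightarrow> (AE t in M. cmod (f t) \<le> 1)"
  unfolding unit_ball_def using vnorm_q[of f 1] q_vecs by simp

lemma AE_le_vnorm: "f \<in> V \<Longrightarrow> AE t in M. cmod (f t) \<le> vnorm X (q f)"
  using vnorm_q[OF _ vnorm_nonneg] by blast

lemma op_norm_le:
  assumes "\<And>f. f \<in> V \<Longrightarrow> AE t in M. cmod (f t) \<le> 1 \<Longrightarrow> norm (T (q f)) \<le> K"
  shows "op_norm X T \<le> K"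
  unfolding op_norm_def
proof (rule cSUP_least)
  show "unit_ball X \<noteq> {}" using unit_ball_q[OF V_zero] by auto
  fix x assume x: "x \<in> unit_ball X"
  then obtain f where "f \<in> V" "x = q f" unfolding unit_ball_def by (auto elim: vecs_cases)
  then show "norm (T x) \<le> K" using assms unit_ball_q x by blast
qed

lemma norm_le_op_norm:
  assumes T: "T \<in> bounded_ops X" and f: "f \<in> V" "AE t in M. cmod (f t) \<le> 1"
  shows "norm (T (q f)) \<le> op_norm X T"
proof -
  obtain K where K: "\<And>x. x \<in> vecs X \<Longrightarrow> norm (T x) \<le> K * vnorm X x"
    using T unfolding bounded_ops_def by blast
  have "norm (T x) \<le> \<bar>K\<bar>" if x: "x \<in> unit_ball X" for x
  proof -
    have x': "x \<in> vecs X" "vnorm X x \<le> 1" using x unfolding unit_ball_def by auto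
    then have "0 \<le> vnorm X x" using vnorm_nonneg by (auto elim: vecs_cases)
    then have "K * vnorm X x \<le> \<bar>K\<bar> * 1" using x' by (intro mult_mono) auto
    then show ?thesis using K[OF x'(1)] by simp
  qed
  then have "bdd_above ((\<lambda>x. norm (T x)) ` unit_ball X)" by (rule bdd_aboveI2)
  then show ?thesis
    unfolding op_norm_def using unit_ball_q[OF f(1)] f(2) by (intro cSUP_upper) auto
qed

lemma bounded_ops_add:
  assumes "T \<in> bounded_ops X" "f \<in> V" "g \<in> V"
  shows "T (q (\<lambda>t. f t + g t)) = T (q f) + T (q g)"
proof -
  have "T (vadd X (q f) (q g)) = T (q f) + T (q g)"
    using assms q_vecs unfolding bounded_ops_def by blast
  then show ?thesis using assms by (simp add: vadd_q)
qed

lemma bounded_ops_scale: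
  assumes "T \<in> bounded_ops X" "f \<in> V"
  shows "T (q (\<lambda>t. a * f t)) = a *\<^sub>C T (q f)"
proof -
  have "T (vscale X a (q f)) = a *\<^sub>C T (q f)"
    using assms q_vecs unfolding bounded_ops_def by blast
  then show ?thesis using assms by (simp add: vscale_q)
qed

lemma bounded_ops_diff:
  assumes "T \<in> bounded_ops X" "f \<in> V" "g \<in> V"
  shows "T (q (\<lambda>t. f t - g t)) = T (q f) - T (q g)"
  using bounded_ops_add[OF assms(1,2) V_scale[OF assms(3), of "- 1"]]
    bounded_ops_scale[OF assms(1,3), of "- 1"] by simp

lemma bounded_ops_minus:
  assumes S: "S \<in> bounded_ops X" and T: "T \<in> bounded_ops X"
  shows "(\<lambda>z. S z - T z) \<in> bounded_ops X"
proof -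
  obtain K where K: "\<And>x. x \<in> vecs X \<Longrightarrow> norm (S x) \<le> K * vnorm X x"
    using S unfolding bounded_ops_def by blast
  obtain L where L: "\<And>x. x \<in> vecs X \<Longrightarrow> norm (T x) \<le> L * vnorm X x"
    using T unfolding bounded_ops_def by blast
  have "norm (S x - T x) \<le> (K + L) * vnorm X x" if "x \<in> vecs X" for x
    using K[OF that] L[OF that] norm_triangle_ineq4[of "S x" "T x"] by (simp add: distrib_right)
  then show ?thesis
    using S T unfolding bounded_ops_def
    by (auto simp: complex_vector.scale_right_diff_distrib)
qed

lemma bounded_ops_rep:
  assumes S: "S \<in> ops_bounded_by M K"
  shows "(\<lambda>z. S (rep z)) \<in> bounded_ops X" "\<And>f. f \<in> V \<Longrightarrow> S (rep (q f)) = S f"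
proof -
  show eq: "S (rep (q f)) = S f" if "f \<in> V" for f
    using V_ess_bdd rep[OF q_vecs[OF that]] that
    by (intro ops_cong_AE[OF S] q_eqD) auto
  have ess: "f \<in> ess_bdd M" if "f \<in> V" for f using that V_ess_bdd by blast
  have "S (rep (vadd X x y)) = S (rep x) + S (rep y)" if "x \<in> vecs X" "y \<in> vecs X" for x y
  proof -
    note r = rep[OF that(1)] rep[OF that(2)]
    have "vadd X x y = q (\<lambda>t. rep x t + rep y t)" using vadd_q[OF r(1,3)] r(2,4) by simp
    then have "S (rep (vadd X x y)) = S (\<lambda>t. rep x t + rep y t)" using eq[OF V_add[OF r(1,3)]] by simp
    then show ?thesis using ops_add[OF S ess[OF r(1)] ess[OF r(3)]] by simp
  qed
  moreover have "S (rep (vscale X a x)) = a *\<^sub>C S (rep x)" if "x \<in> vecs X" for a x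
  proof -
    note r = rep[OF that]
    have "vscale X a x = q (\<lambda>t. a * rep x t)" using vscale_q[OF r(1)] r(2) by simp
    then have "S (rep (vscale X a x)) = S (\<lambda>t. a * rep x t)" using eq[OF V_scale[OF r(1)]] by simp
    then show ?thesis using ops_scale[OF S ess[OF r(1)]] by simp
  qed
  moreover have "norm (S (rep x)) \<le> K * vnorm X x" if "x \<in> vecs X" for x
    using ops_bound[OF S ess vnorm_nonneg AE_le_vnorm, of "rep x"] rep[OF that] by simp
  ultimately show "(\<lambda>z. S (rep z)) \<in> bounded_ops X" unfolding bounded_ops_def by blast
qed

section \<open>Uniform convexity implies the Bishop--Phelps--Bollobas property\<close>

text \<open>
  Let \<open>A\<close> be the set where the modulus of \<open>x\<close> is close to 1, and \<open>u\<close> the phase of \<open>x\<close> there. The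
  operator \<open>T\<^sub>0\<close> given by \<open>g \<mapsto> T (u g)\<close> is defined on all essentially bounded functions on \<open>A\<close>, also when the constant function 1 does not belong to \<open>V\<close>. The
  measure with density the indicator of \<open>A\<close> encodes \<open>L\<^sub>\<infinity>(A)\<close> without changing the underlying set.
\<close>

lemma convex_imp_BPBp_RSE:
  assumes Y: "C_uniformly_convex TYPE('b::complex_banach)"
  shows "BPBp_RSE X TYPE('b)"
  unfolding BPBp_RSE_def
proof (intro allI impI)
  fix \<epsilon> :: real assume \<epsilon>: "\<epsilon> > 0"
  define e where "e = \<epsilon> / 3"
  have e: "e > 0" using \<epsilon> by (simp add: e_def)
  obtain \<eta>\<^sub>0 where \<eta>\<^sub>0: "\<eta>\<^sub>0 > 0" and attain:
    "\<And>(M :: 'a measure) (T :: ('a \<Rightarrow> complex) \<Rightarrow> 'b). T \<in> ops_bounded_by M 1 \<Longrightarrow>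
      norm (T (\<lambda>_. 1)) > 1 - \<eta>\<^sub>0 \<Longrightarrow> \<exists>S\<in>ops_bounded_by M 1.
      norm (S (\<lambda>_. 1)) = 1 \<and> (\<lambda>f. S f - T f) \<in> ops_bounded_by M e \<and>
      (\<forall>f :: nat \<Rightarrow> 'a \<Rightarrow> complex. (\<forall>n. f n \<in> ess_bdd M \<and> (AE t in M. cmod (f n t) \<le> 1)) \<and>
        (\<lambda>n. norm (S (f n))) \<longlonglongrightarrow> 1 \<longrightarrow>
        (\<exists>\<sigma> \<theta>. strict_mono \<sigma> \<and> cmod \<theta> = 1 \<and> (\<lambda>n. S (f (\<sigma> n))) \<longlonglongrightarrow> \<theta> *\<^sub>C S (\<lambda>_. 1)))"
    using attain_strongly_at_one[OF Y e, where ?'a = 'a] by blast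
  define \<beta> where "\<beta> = min (min (1 / 2) e) (\<eta>\<^sub>0 / 4)"
  have \<beta>: "\<beta> > 0" "\<beta> \<le> 1 / 2" "\<beta> \<le> e" "\<beta> \<le> \<eta>\<^sub>0 / 4" using e \<eta>\<^sub>0 by (auto simp: \<beta>_def)
  \<comment> \<open>The functions added to \<open>x\<close> have size \<open>\<beta>\<close>, and \<open>T\<close> restricted to them is to have norm at most \<open>\<beta>\<close>.\<close>
  obtain \<delta> where \<delta>: "\<delta> > 0" and convex: "\<And>y0 y1 :: 'b.
      (\<And>w. cmod w = 1 \<Longrightarrow> norm (y0 + w *\<^sub>C y1) \<le> 1) \<Longrightarrow> norm y1 > \<beta> * \<beta> \<Longrightarrow> norm y0 < 1 - \<delta>"
    using Y[unfolded C_uniformly_convex_def, rule_format, of "\<beta> * \<beta>"] \<beta> by auto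
  define \<eta> where "\<eta> = min (min \<delta> (\<eta>\<^sub>0 / 4)) (\<epsilon> / 2)"
  have \<eta>: "\<eta> > 0" "\<eta> < \<epsilon>" "\<eta> \<le> \<delta>" "\<eta> \<le> \<eta>\<^sub>0 / 4" using \<delta> \<eta>\<^sub>0 \<epsilon> by (auto simp: \<eta>_def)
  have "\<exists>S\<in>RSE X. \<exists>x0\<in>unit_sphere X. op_norm X S = 1 \<and> norm (S x0) = 1 \<and>
      op_norm X (\<lambda>z. S z - T z) < \<epsilon> \<and> vnorm X (vdiff X z x0) < \<epsilon>"
    if T: "T \<in> bounded_ops X" and z: "z \<in> unit_sphere X"
      and T1: "op_norm X T = 1" and Tz: "norm (T z) > 1 - \<eta>"
    for T :: "'x \<Rightarrow> 'b" and z
  proof -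
    obtain x where x: "x \<in> V" "z = q x" using z unfolding unit_sphere_def by (auto elim: vecs_cases)
    have x1: "AE t in M. cmod (x t) \<le> 1"
      using z x vnorm_q[of x 1] unfolding unit_sphere_def by simp
    note [measurable] = V_measurable[OF x(1)]
    have T_le: "norm (T (q f)) \<le> 1" if "f \<in> V" "AE t in M. cmod (f t) \<le> 1" for f
      using norm_le_op_norm[OF T that] T1 by simp
    have T_le_scaled: "norm (T (q f)) \<le> c" if "f \<in> V" "AE t in M. cmod (f t) \<le> c" "c > 0" for f c
    proof -
      have "AE t in M. cmod (of_real (1 / c) * f t) \<le> 1"
        using that(2) by eventually_elim (use that(3) in \<open>simp add: norm_mult norm_divide field_simps\<close>)
      then have "norm (T (q (\<lambda>t. of_real (1 / c) * f t))) \<le> 1" by (intro T_le V_scale that)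
      then show ?thesis
        using that(3) unfolding bounded_ops_scale[OF T that(1)] by (simp add: norm_scaleC norm_divide)
    qed
    define A where "A = {t \<in> space M. cmod (x t) > 1 - \<beta>}"
    have A [measurable]: "A \<in> sets M" unfolding A_def by measurable
    \<comment> \<open>Off \<open>A\<close> the function \<open>x\<close> leaves room for perturbations of size \<open>\<beta>\<close>.\<close>
    have off: "norm (T (q f)) \<le> \<beta>"
      if f: "f \<in> V" "AE t in M. cmod (f t) \<le> 1" "AE t in M. t \<in> A \<longrightarrow> f t = 0" for f
    proof (rule ccontr)
      assume "\<not> ?thesis"
      then have "norm (of_real \<beta> *\<^sub>C T (q f)) > \<beta> * \<beta>" using \<beta> by (simp add: norm_scaleC)
      moreover have "norm (T z + w *\<^sub>C (of_real \<beta> *\<^sub>C T (q f))) \<le> 1" if w: "cmod w = 1" for w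
      proof -
        have "AE t in M. cmod (x t + (w * of_real \<beta>) * f t) \<le> 1"
          using x1 f(2,3) AE_space
        proof eventually_elim
          case (elim t)
          show ?case
          proof (cases "t \<in> A")
            case False
            have "cmod (x t + (w * of_real \<beta>) * f t) \<le> cmod (x t) + \<beta> * cmod (f t)"
              using norm_triangle_ineq[of "x t" "(w * of_real \<beta>) * f t"] w \<beta> by (simp add: norm_mult)
            also have "\<dots> \<le> (1 - \<beta>) + \<beta> * 1"
              using False elim \<beta> by (intro add_mono mult_left_mono) (auto simp: A_def)
            finally show ?thesis by simp
          qed (use elim in auto)
        qed
        then have "norm (T (q (\<lambda>t. x t + (w * of_real \<beta>) * f t))) \<le> 1"
          by (intro T_le V_add V_scale x f)
        then show ?thesis
          unfolding bounded_ops_add[OF T x(1) V_scale[OF f(1)]] bounded_ops_scale[OF T f(1)]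
          by (simp add: x(2) scaleC_scaleC)
      qed
      ultimately have "norm (T z) < 1 - \<delta>" by (intro convex)
      then show False using Tz \<eta> by simp
    qed
    define u where "u t = (if t \<in> A then sgn (x t) else 0)" for t
    have u_meas [measurable]: "u \<in> borel_measurable M"
      unfolding u_def sgn_div_norm by measurable
    have u_le: "cmod (u t) \<le> 1" for t by (simp add: u_def norm_sgn)
    have u_A: "u t * cnj (u t) = 1" if "t \<in> A" for t
    proof -
      have "x t \<noteq> 0" using that \<beta> by (auto simp: A_def)
      then have "cmod (u t) = 1" using that by (simp add: u_def norm_sgn)
      then show ?thesis using complex_norm_square[of "u t"] by simp
    qed
    have x_sgn: "x t = of_real (cmod (x t)) * u t" if "t \<in> A" for t
      using that by (simp add: u_def sgn_eq)
    have uV: "u \<in> V"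
    proof (rule V_ideal[OF x(1) u_meas])
      show "AE t in M. cmod (u t) \<le> 2 * cmod (x t)"
      proof (rule AE_I2)
        fix t
        show "cmod (u t) \<le> 2 * cmod (x t)"
          using u_le[of t] \<beta> by (cases "t \<in> A") (auto simp: A_def u_def)
      qed
    qed
    \<comment> \<open>The norm of the operator constructed below is attained at \<open>y\<close>.\<close>
    define y where "y t = (if t \<in> A then u t else x t)" for t
    have yV: "y \<in> V"
    proof (rule V_ideal[OF x(1)])
      show "AE t in M. cmod (y t) \<le> 2 * cmod (x t)"
      proof (rule AE_I2)
        fix t
        show "cmod (y t) \<le> 2 * cmod (x t)"
          using u_le[of t] \<beta> by (cases "t \<in> A") (auto simp: A_def y_def)
      qed
    qed (unfold y_def, measurable)
    have y1: "AE t in M. cmod (y t) \<le> 1"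
      using x1 by eventually_elim (use u_le in \<open>simp add: y_def\<close>)
    have xy: "AE t in M. cmod (x t - y t) \<le> \<beta>"
      using x1
    proof eventually_elim
      case (elim t)
      show ?case
      proof (cases "t \<in> A")
        case True
        have "x t - u t = of_real (cmod (x t) - 1) * u t"
          by (subst x_sgn[OF True]) (simp add: algebra_simps)
        then have "cmod (x t - u t) = \<bar>cmod (x t) - 1\<bar> * cmod (u t)"
          by (simp only: norm_mult norm_of_real)
        also have "\<dots> \<le> \<bar>cmod (x t) - 1\<bar> * 1" using u_le[of t] by (intro mult_left_mono) auto
        finally show ?thesis using True elim by (simp add: y_def A_def)
      qed (use \<beta> in \<open>simp add: y_def\<close>)
    qed
    have mult_u: "(\<lambda>t. u t * g t) \<in> V"
      if "g \<in> borel_measurable M" "AE t in M. t \<in> A \<longrightarrow> cmod (g t) \<le> C" for g C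
    proof (rule V_ideal[OF uV])
      show "AE t in M. cmod (u t * g t) \<le> C * cmod (u t)"
        using that(2)
        by eventually_elim (auto simp: u_def norm_mult mult.commute[of C] intro: mult_left_mono)
    qed (use that in measurable)
    define N where "N = density M (indicator A)"
    have AE_N: "(AE t in N. P t) \<longleftrightarrow> (AE t in M. t \<in> A \<longrightarrow> P t)" for P
      unfolding N_def by (subst AE_density) (auto simp: indicator_def)
    have ess_N: "g \<in> ess_bdd N \<longleftrightarrow> g \<in> borel_measurable M \<and> (\<exists>C. AE t in M. t \<in> A \<longrightarrow> cmod (g t) \<le> C)" for g
      unfolding ess_bdd_def AE_N by (simp add: N_def)
    have mult_u': "(\<lambda>t. u t * g t) \<in> V" if "g \<in> ess_bdd N" for g
      using that mult_u unfolding ess_N by blast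
    define T\<^sub>0 where "T\<^sub>0 g = T (q (\<lambda>t. u t * g t))" for g
    have T\<^sub>0: "T\<^sub>0 \<in> ops_bounded_by N 1"
    proof (rule ops_bounded_byI)
      fix f g assume fg: "f \<in> ess_bdd N" "g \<in> ess_bdd N"
      show "T\<^sub>0 (\<lambda>t. f t + g t) = T\<^sub>0 f + T\<^sub>0 g"
        using bounded_ops_add[OF T mult_u'[OF fg(1)] mult_u'[OF fg(2)]]
        by (simp add: T\<^sub>0_def distrib_left)
    next
      fix a f assume f: "f \<in> ess_bdd N"
      show "T\<^sub>0 (\<lambda>t. a * f t) = a *\<^sub>C T\<^sub>0 f"
        using bounded_ops_scale[OF T mult_u'[OF f]] by (simp add: T\<^sub>0_def mult.left_commute)
    next
      fix f assume f: "f \<in> ess_bdd N" "AE t in N. cmod (f t) \<le> 1"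
      have "AE t in M. cmod (u t * f t) \<le> 1"
        using f(2) unfolding AE_N
      proof eventually_elim
        case (elim t)
        then show ?case using u_le[of t] by (cases "t \<in> A") (auto simp: norm_mult mult_le_one u_def)
      qed
      then show "norm (T\<^sub>0 f) \<le> 1" unfolding T\<^sub>0_def by (intro T_le mult_u' f)
    qed
    have "norm (T\<^sub>0 (\<lambda>_. 1)) > 1 - \<eta>\<^sub>0"
    proof -
      define r where "r t = x t - y t" for t
      define s where "s t = (if t \<in> A then 0 else x t)" for t
      have rV: "r \<in> V" unfolding r_def by (rule V_diff[OF x(1) yV])
      have sV: "s \<in> V"
      proof (rule V_ideal[OF x(1)])
        show "AE t in M. cmod (s t) \<le> 1 * cmod (x t)" by (auto simp: s_def)
      qed (unfold s_def, measurable)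
      have "AE t in M. cmod (r t) \<le> \<beta>" unfolding r_def by (rule xy)
      then have "norm (T (q r)) \<le> \<beta>" using \<beta> rV by (intro T_le_scaled)
      moreover have "norm (T (q s)) \<le> \<beta>"
      proof (rule off[OF sV])
        show "AE t in M. cmod (s t) \<le> 1" using x1 by eventually_elim (simp add: s_def)
      qed (simp add: s_def)
      moreover have "T z = T (q u) + (T (q r) + T (q s))"
      proof -
        have "x = (\<lambda>t. u t + (r t + s t))" by (auto simp: r_def s_def y_def u_def)
        then show ?thesis
          using bounded_ops_add[OF T uV V_add[OF rV sV]] bounded_ops_add[OF T rV sV] x(2) by simp
      qed
      then have "norm (T z) \<le> norm (T (q u)) + (norm (T (q r)) + norm (T (q s)))"
        using norm_triangle_ineq[of "T (q u)" "T (q r) + T (q s)"]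
          norm_triangle_ineq[of "T (q r)" "T (q s)"] by simp
      ultimately have "norm (T (q u)) > 1 - \<eta>\<^sub>0" using Tz \<beta> \<eta> \<eta>\<^sub>0 by linarith
      then show ?thesis by (simp add: T\<^sub>0_def)
    qed
    from attain[OF T\<^sub>0 this] obtain S\<^sub>0 where S\<^sub>0: "S\<^sub>0 \<in> ops_bounded_by N 1" "norm (S\<^sub>0 (\<lambda>_. 1)) = 1"
      and ST: "(\<lambda>f. S\<^sub>0 f - T\<^sub>0 f) \<in> ops_bounded_by N e"
      and strong: "\<And>f :: nat \<Rightarrow> 'a \<Rightarrow> complex. (\<And>n. f n \<in> ess_bdd N) \<Longrightarrow>
        (\<And>n. AE t in N. cmod (f n t) \<le> 1) \<Longrightarrow> (\<lambda>n. norm (S\<^sub>0 (f n))) \<longlonglongrightarrow> 1 \<Longrightarrow>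
        \<exists>\<sigma> \<theta>. strict_mono \<sigma> \<and> cmod \<theta> = 1 \<and> (\<lambda>n. S\<^sub>0 (f (\<sigma> n))) \<longlonglongrightarrow> \<theta> *\<^sub>C S\<^sub>0 (\<lambda>_. 1)"
      by blast
    define c where "c t = cnj (u t)" for t
    have cnj [measurable]: "cnj \<in> borel_measurable borel"
      by (intro borel_measurable_continuous_onI continuous_intros)
    have c_meas [measurable]: "c \<in> borel_measurable M"
      unfolding c_def by measurable
    have cf: "(\<lambda>t. c t * f t) \<in> ess_bdd N" if fM: "f \<in> ess_bdd M" for f
    proof -
      obtain C where C: "AE t in M. cmod (f t) \<le> C" using fM unfolding ess_bdd_def by blast
      note [measurable] = ess_bdd_measurable[OF fM]
      have "AE t in M. t \<in> A \<longrightarrow> cmod (c t * f t) \<le> C"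
        using C
      proof eventually_elim
        case (elim t)
        have "cmod (c t * f t) \<le> 1 * cmod (f t)"
          unfolding norm_mult using u_le[of t] by (intro mult_right_mono) (auto simp: c_def)
        then show ?case using elim by simp
      qed
      moreover have "(\<lambda>t. c t * f t) \<in> borel_measurable M" by measurable
      ultimately show ?thesis unfolding ess_N by blast
    qed
    have cf1: "AE t in N. cmod (c t * f t) \<le> 1" if "AE t in M. cmod (f t) \<le> 1" for f
      unfolding AE_N using that
      by eventually_elim (use u_le in \<open>auto simp: norm_mult c_def intro!: mult_le_one\<close>)
    define S\<^sub>1 where "S\<^sub>1 f = S\<^sub>0 (\<lambda>t. c t * f t)" for f
    have S\<^sub>1: "S\<^sub>1 \<in> ops_bounded_by M 1"
    proof (rule ops_bounded_byI)
      fix f g assume fg: "f \<in> ess_bdd M" "g \<in> ess_bdd M"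
      show "S\<^sub>1 (\<lambda>t. f t + g t) = S\<^sub>1 f + S\<^sub>1 g"
        using ops_add[OF S\<^sub>0(1) cf[OF fg(1)] cf[OF fg(2)]] by (simp add: S\<^sub>1_def distrib_left)
    next
      fix a f assume f: "f \<in> ess_bdd M"
      show "S\<^sub>1 (\<lambda>t. a * f t) = a *\<^sub>C S\<^sub>1 f"
        using ops_scale[OF S\<^sub>0(1) cf[OF f]] by (simp add: S\<^sub>1_def mult.left_commute)
    next
      fix f assume f: "f \<in> ess_bdd M" "AE t in M. cmod (f t) \<le> 1"
      show "norm (S\<^sub>1 f) \<le> 1"
        using ops_bound[OF S\<^sub>0(1) cf[OF f(1)] _ cf1[OF f(2)]] by (simp add: S\<^sub>1_def)
    qed
    define S where "S z = S\<^sub>1 (rep z)" for z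
    have S: "S \<in> bounded_ops X" and Sq: "\<And>f. f \<in> V \<Longrightarrow> S (q f) = S\<^sub>1 f"
      unfolding S_def[abs_def] by (fact bounded_ops_rep[OF S\<^sub>1])+
    have Sy: "S (q y) = S\<^sub>0 (\<lambda>_. 1)"
      unfolding Sq[OF yV] S\<^sub>1_def
    proof (rule ops_cong_AE[OF S\<^sub>0(1)])
      show "(\<lambda>t. c t * y t) \<in> ess_bdd N" using cf V_ess_bdd yV by blast
      show "AE t in N. c t * y t = 1"
        unfolding AE_N using u_A by (simp add: c_def y_def mult.commute)
    qed simp
    have S_norm: "op_norm X S = 1"
    proof (rule antisym)
      show "op_norm X S \<le> 1"
      proof (rule op_norm_le)
        fix f assume f: "f \<in> V" "AE t in M. cmod (f t) \<le> 1"
        then show "norm (S (q f)) \<le> 1"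
          using ops_bound[OF S\<^sub>1 _ _ f(2)] V_ess_bdd by (auto simp: Sq)
      qed
      show "1 \<le> op_norm X S" using norm_le_op_norm[OF S yV y1] Sy S\<^sub>0(2) by simp
    qed
    have y_sphere: "q y \<in> unit_sphere X"
    proof -
      have le: "vnorm X (q y) \<le> 1" using vnorm_q[OF yV] y1 by simp
      moreover have "\<not> vnorm X (q y) < 1"
      proof
        assume less: "vnorm X (q y) < 1"
        have "norm (S\<^sub>1 y) \<le> 1 * vnorm X (q y)"
          using V_ess_bdd yV by (intro ops_bound[OF S\<^sub>1 _ vnorm_nonneg AE_le_vnorm]) auto
        then show False using less Sy S\<^sub>0(2) Sq[OF yV] by simp
      qed
      ultimately show ?thesis unfolding unit_sphere_def using q_vecs[OF yV] by simp
    qed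
    have "S \<in> RSE X"
      unfolding RSE_def
    proof (intro CollectI conjI S bexI[OF _ y_sphere] allI impI)
      fix w :: "nat \<Rightarrow> 'x"
      assume "(\<forall>n. w n \<in> unit_ball X) \<and> (\<lambda>n. norm (S (w n))) \<longlonglongrightarrow> op_norm X S"
      then have w: "\<And>n. w n \<in> unit_ball X" and lim: "(\<lambda>n. norm (S (w n))) \<longlonglongrightarrow> 1"
        using S_norm by auto
      have wV: "rep (w n) \<in> V" "q (rep (w n)) = w n" for n
        using rep w unfolding unit_ball_def by auto
      have w1: "AE t in M. cmod (rep (w n) t) \<le> 1" for n
        using unit_ball_q[OF wV(1)] w wV(2) by simp
      have Sw: "S (w n) = S\<^sub>0 (\<lambda>t. c t * rep (w n) t)" for n by (simp add: S_def S\<^sub>1_def)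
      show "\<exists>\<sigma> \<theta>. strict_mono \<sigma> \<and> cmod \<theta> = 1 \<and> (\<lambda>n. S (w (\<sigma> n))) \<longlonglongrightarrow> \<theta> *\<^sub>C S (q y)"
        unfolding Sy Sw
      proof (rule strong)
        show "(\<lambda>t. c t * rep (w n) t) \<in> ess_bdd N" for n using cf V_ess_bdd wV by blast
        show "AE t in N. cmod (c t * rep (w n) t) \<le> 1" for n by (rule cf1[OF w1])
        show "(\<lambda>n. norm (S\<^sub>0 (\<lambda>t. c t * rep (w n) t))) \<longlonglongrightarrow> 1" using lim by (simp add: Sw)
      qed
    qed
    moreover have "op_norm X (\<lambda>z. S z - T z) < \<epsilon>"
    proof -
      have "op_norm X (\<lambda>z. S z - T z) \<le> e + \<beta>"
      proof (rule op_norm_le)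
        fix f assume f: "f \<in> V" "AE t in M. cmod (f t) \<le> 1"
        define k where "k t = (if t \<in> A then 0 else f t)" for t
        note [measurable] = V_measurable[OF f(1)]
        have kV: "k \<in> V"
        proof (rule V_ideal[OF f(1)])
          show "AE t in M. cmod (k t) \<le> 1 * cmod (f t)" by (auto simp: k_def)
        qed (unfold k_def, measurable)
        have fM: "f \<in> ess_bdd M" using f V_ess_bdd by blast
        have ucV: "(\<lambda>t. u t * (c t * f t)) \<in> V" by (rule mult_u'[OF cf[OF fM]])
        have "f = (\<lambda>t. u t * (c t * f t) + k t)"
        proof
          fix t
          show "f t = u t * (c t * f t) + k t"
            using u_A[of t] by (cases "t \<in> A") (simp_all add: u_def k_def c_def flip: mult.assoc)
        qed
        then have "T (q f) = T\<^sub>0 (\<lambda>t. c t * f t) + T (q k)"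
          using bounded_ops_add[OF T ucV kV] by (simp add: T\<^sub>0_def)
        then have "S (q f) - T (q f) = (S\<^sub>0 (\<lambda>t. c t * f t) - T\<^sub>0 (\<lambda>t. c t * f t)) - T (q k)"
          using Sq[OF f(1)] by (simp add: S\<^sub>1_def)
        moreover have "norm (S\<^sub>0 (\<lambda>t. c t * f t) - T\<^sub>0 (\<lambda>t. c t * f t)) \<le> e * 1"
          by (intro ops_bound[OF ST cf[OF fM] _ cf1[OF f(2)]]) simp
        moreover have "norm (T (q k)) \<le> \<beta>"
        proof (rule off[OF kV])
          show "AE t in M. cmod (k t) \<le> 1" using f(2) by eventually_elim (simp add: k_def)
        qed (simp add: k_def)
        ultimately show "norm (S (q f) - T (q f)) \<le> e + \<beta>"
          using norm_triangle_ineq4[of "S\<^sub>0 (\<lambda>t. c t * f t) - T\<^sub>0 (\<lambda>t. c t * f t)" "T (q k)"] by simp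
      qed
      then show ?thesis using \<beta>(3) \<epsilon> unfolding e_def by linarith
    qed
    moreover have "vnorm X (vdiff X z (q y)) < \<epsilon>"
    proof -
      have "vnorm X (vdiff X z (q y)) \<le> \<beta>"
        unfolding x(2) vdiff_q[OF x(1) yV] using vnorm_q[OF V_diff[OF x(1) yV]] xy \<beta> by simp
      then show ?thesis using \<beta>(3) \<epsilon> unfolding e_def by linarith
    qed
    moreover have "norm (S (q y)) = 1" using Sy S\<^sub>0(2) by simp
    ultimately show ?thesis using S_norm y_sphere by blast
  qed
  then show "\<exists>\<eta>>0. \<eta> < \<epsilon> \<and> (\<forall>T \<in> (bounded_ops X :: ('x \<Rightarrow> 'b) set). \<forall>x\<in>unit_sphere X.
      op_norm X T = 1 \<and> norm (T x) > 1 - \<eta> \<longrightarrow>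
      (\<exists>S\<in>RSE X. \<exists>x0\<in>unit_sphere X. op_norm X S = 1 \<and> norm (S x0) = 1 \<and>
         op_norm X (\<lambda>z. S z - T z) < \<epsilon> \<and> vnorm X (vdiff X x x0) < \<epsilon>))"
    using \<eta> by (intro exI[of _ \<eta>]) blast
qed

end

section \<open>The Bishop--Phelps--Bollobas property implies uniform convexity\<close>

text \<open>
  Limits along an ultrafilter that contains the given set and all sets of full measure. Integrals
  would not do, since the set may be an atom of infinite measure.
\<close>

lemma functional_concentrated_on:
  assumes "\<not> (AE t in M. \<not> P t)"
  obtains \<phi> :: "('a \<Rightarrow> complex) \<Rightarrow> complex"
    where "\<forall>f\<in>ess_bdd M. \<forall>g\<in>ess_bdd M. \<phi> (\<lambda>t. f t + g t) = \<phi> f + \<phi> g"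
      and "\<forall>a. \<forall>f\<in>ess_bdd M. \<phi> (\<lambda>t. a * f t) = a * \<phi> f"
      and "\<forall>f\<in>ess_bdd M. \<forall>C. (AE t in M. cmod (f t) \<le> C) \<longrightarrow> cmod (\<phi> f) \<le> C"
      and "\<forall>f c. (\<forall>t. P t \<longrightarrow> f t = c) \<longrightarrow> \<phi> f = c"
proof -
  have "inf (ae_filter M) (principal {t. P t}) \<noteq> bot"
    using assms by (simp add: trivial_limit_def eventually_inf_principal)
  then obtain U where U_le: "U \<le> inf (ae_filter M) (principal {t. P t})" and U: "U \<noteq> bot"
    and ultra: "\<And>Q. eventually Q U \<or> eventually (\<lambda>x. \<not> Q x) U"
    using ultrafilter_below by blast
  have AE_U: "eventually Q U" if "AE t in M. Q t" for Q
    using U_le that by (auto intro: filter_leD)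
  have P_U: "eventually P U" using U_le by (simp add: le_principal)
  define \<phi> where "\<phi> f = Lim U f" for f :: "'a \<Rightarrow> complex"
  have \<phi>I: "\<phi> f = l" if "(f \<longlongrightarrow> l) U" for f l
    unfolding \<phi>_def by (rule tendsto_Lim[OF U that])
  have lim: "(f \<longlongrightarrow> \<phi> f) U" if f: "f \<in> ess_bdd M" for f
  proof -
    obtain C where "AE t in M. cmod (f t) \<le> C" using f unfolding ess_bdd_def by blast
    then obtain l where "(f \<longlongrightarrow> l) U"
      using ultrafilter_bounded_limit[OF U ultra AE_U] by blast
    then show ?thesis using \<phi>I by simp
  qed
  have "\<phi> (\<lambda>t. f t + g t) = \<phi> f + \<phi> g" if "f \<in> ess_bdd M" "g \<in> ess_bdd M" for f g
    by (intro \<phi>I tendsto_add lim that)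
  moreover have "\<phi> (\<lambda>t. a * f t) = a * \<phi> f" if "f \<in> ess_bdd M" for a f
    by (intro \<phi>I tendsto_mult tendsto_const lim that)
  moreover have "cmod (\<phi> f) \<le> C" if "f \<in> ess_bdd M" "AE t in M. cmod (f t) \<le> C" for f C
    by (rule tendsto_upperbound[OF tendsto_norm[OF lim[OF that(1)]] AE_U[OF that(2)] U])
  moreover have "\<phi> f = c" if "\<forall>t. P t \<longrightarrow> f t = c" for f c
    using P_U that by (intro \<phi>I tendsto_eventually) (auto elim: eventually_mono)
  ultimately show thesis by (intro that[of \<phi>]) blast+
qed

text \<open>After a rotation \<open>z\<close> is the common real part \<open>r\<close> of two conjugate unimodular numbers.\<close>

lemma average_of_unimodular:
  assumes "cmod z \<le> 1"
  obtains w1 w2 where "cmod w1 = 1" "cmod w2 = 1" "z = (w1 + w2) / 2"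
proof -
  obtain \<theta> where \<theta>: "cmod \<theta> = 1" "\<theta> * z = of_real (cmod z)" using rotation_to_modulus by blast
  define r where "r = cmod z"
  have r: "r\<^sup>2 \<le> 1" using assms by (simp add: r_def power_le_one)
  define v1 where "v1 = Complex r (sqrt (1 - r\<^sup>2))"
  define v2 where "v2 = Complex r (- sqrt (1 - r\<^sup>2))"
  have v: "cmod v1 = 1" "cmod v2 = 1" using r by (simp_all add: v1_def v2_def cmod_def)
  have "\<theta> * cnj \<theta> = 1" using complex_norm_square[of \<theta>] \<theta> by simp
  then have "z = cnj \<theta> * (\<theta> * z)" by (simp add: mult.commute flip: mult.assoc)
  also have "\<dots> = cnj \<theta> * ((v1 + v2) / 2)"
    unfolding \<theta>(2) by (simp add: v1_def v2_def r_def complex_eq_iff)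
  finally have "z = (cnj \<theta> * v1 + cnj \<theta> * v2) / 2" by (simp add: algebra_simps)
  then show ?thesis using that[of "cnj \<theta> * v1" "cnj \<theta> * v2"] v \<theta> by (simp add: norm_mult)
qed

lemma norm_combination_le:
  fixes y0 y1 :: "'b::complex_banach"
  assumes circle: "\<And>w. cmod w = 1 \<Longrightarrow> norm (y0 + w *\<^sub>C y1) \<le> 1"
    and a: "cmod a \<le> 1" and b: "cmod b \<le> 1"
  shows "norm (a *\<^sub>C y0 + b *\<^sub>C y1) \<le> 1"
proof -
  have avg: "norm ((1 / 2) *\<^sub>C (u + v)) \<le> 1" if "norm u \<le> 1" "norm v \<le> 1" for u v :: 'b
    using that norm_triangle_ineq[of u v] by (simp add: norm_scaleC)
  have average: "(1 / 2) *\<^sub>C ((c *\<^sub>C u + d *\<^sub>C v) + (c' *\<^sub>C u + d' *\<^sub>C v)) =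
      ((c + c') / 2) *\<^sub>C u + ((d + d') / 2) *\<^sub>C v" for c d c' d' and u v :: 'b
  proof -
    have "((c + c') / 2) *\<^sub>C u + ((d + d') / 2) *\<^sub>C v =
        (1 / 2) *\<^sub>C (c + c') *\<^sub>C u + (1 / 2) *\<^sub>C (d + d') *\<^sub>C v" by (simp add: scaleC_scaleC)
    then show ?thesis by (simp only: scaleC_add_right scaleC_add_left add_ac)
  qed
  have unimodular: "norm (c *\<^sub>C y0 + d *\<^sub>C y1) \<le> 1" if "cmod c = 1" "cmod d = 1" for c d
  proof -
    have "c *\<^sub>C y0 + d *\<^sub>C y1 = c *\<^sub>C (y0 + (d / c) *\<^sub>C y1)"
      using that(1) by (auto simp: scaleC_add_right scaleC_scaleC)
    then show ?thesis using circle[of "d / c"] that by (simp add: norm_scaleC norm_divide)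
  qed
  have half: "norm (c *\<^sub>C y0 + b *\<^sub>C y1) \<le> 1" if c: "cmod c = 1" for c
  proof -
    obtain w1 w2 where w: "cmod w1 = 1" "cmod w2 = 1" "b = (w1 + w2) / 2"
      using average_of_unimodular[OF b] .
    have "c *\<^sub>C y0 + b *\<^sub>C y1 = (1 / 2) *\<^sub>C ((c *\<^sub>C y0 + w1 *\<^sub>C y1) + (c *\<^sub>C y0 + w2 *\<^sub>C y1))"
      using w(3) average[of c y0 w1 y1 c w2] by simp
    then show ?thesis using avg[OF unimodular[OF c w(1)] unimodular[OF c w(2)]] by simp
  qed
  obtain w1 w2 where w: "cmod w1 = 1" "cmod w2 = 1" "a = (w1 + w2) / 2"
    using average_of_unimodular[OF a] .
  have "a *\<^sub>C y0 + b *\<^sub>C y1 = (1 / 2) *\<^sub>C ((w1 *\<^sub>C y0 + b *\<^sub>C y1) + (w2 *\<^sub>C y0 + b *\<^sub>C y1))"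
    using w(3) average[of w1 y0 b y1 w2 b] by simp
  then show ?thesis using avg[OF half[OF w(1)] half[OF w(2)]] by simp
qed

text \<open>
  The unit circle is strictly convex: \<open>c0\<close> is the midpoint of \<open>c1\<close> and \<open>c2\<close>, hence equal to both.
\<close>

lemma segment_in_rotations_trivial:
  fixes p d v :: "'b::complex_banach"
  assumes "p = c0 *\<^sub>C v" "p + d = c1 *\<^sub>C v" "p - d = c2 *\<^sub>C v"
    and "cmod c0 = 1" "cmod c1 = 1" "cmod c2 = 1" and "v \<noteq> 0"
  shows "d = 0"
proof -
  have "(c1 + c2 - 2 * c0) *\<^sub>C v = c1 *\<^sub>C v + c2 *\<^sub>C v - (c0 *\<^sub>C v + c0 *\<^sub>C v)"
    by (simp only: complex_vector.scale_left_diff_distrib scaleC_add_left mult_2)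
  also have "\<dots> = (p + d) + (p - d) - (p + p)" by (simp only: assms(1)[symmetric] assms(2,3)[symmetric])
  finally have "(c1 + c2 - 2 * c0) *\<^sub>C v = 0" by simp
  then have "c1 + c2 = 2 * c0" using assms(7) by simp
  then have "cmod (c1 + c2) = 2" using assms(4) by (simp add: norm_mult)
  moreover have "(cmod (c1 + c2))\<^sup>2 + (cmod (c1 - c2))\<^sup>2 = 2 * (cmod c1)\<^sup>2 + 2 * (cmod c2)\<^sup>2"
    unfolding cmod_power2 by (simp add: power2_eq_square algebra_simps)
  ultimately have "(cmod (c1 - c2))\<^sup>2 = 0" using assms(5,6) by simp
  then have "c1 = c2" by simp
  then have "p + d = p - d" using assms by simp
  then have "d + d = 0" by (simp add: algebra_simps)
  then have "2 *\<^sub>R d = 0" by (simp add: scaleR_2)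
  then show ?thesis by simp
qed

text \<open>
  Since \<open>p\<close>, \<open>p + d\<close> and \<open>p - d\<close> below are norm attaining values of a range strongly exposing
  operator, they are rotations of a single vector; this takes the place of strict convexity of
  the codomain.
\<close>

lemma (in function_model) BPBp_RSE_imp_convex:
  assumes A: "A \<in> sets M" "indicator A \<in> V" "\<not> (AE t in M. t \<notin> A)"
    and B: "B \<in> sets M" "indicator B \<in> V" "\<not> (AE t in M. t \<notin> B)"
    and disjoint: "A \<inter> B = {}"
    and BPB: "BPBp_RSE X TYPE('b::complex_banach)"
  shows "C_uniformly_convex TYPE('b)"
  unfolding C_uniformly_convex_def
proof (intro allI impI)
  fix \<epsilon> :: real assume \<epsilon>: "\<epsilon> > 0"
  define e where "e = min \<epsilon> (1 / 2)"
  have e: "e > 0" "e \<le> \<epsilon>" "e \<le> 1 / 2" using \<epsilon> by (auto simp: e_def)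
  from BPB[unfolded BPBp_RSE_def, rule_format, OF e(1)]
  obtain \<eta> where \<eta>: "\<eta> > 0" and approx: "\<And>(T :: 'x \<Rightarrow> 'b) x. T \<in> bounded_ops X \<Longrightarrow>
      x \<in> unit_sphere X \<Longrightarrow> op_norm X T = 1 \<Longrightarrow> norm (T x) > 1 - \<eta> \<Longrightarrow>
      \<exists>S\<in>RSE X. \<exists>x0\<in>unit_sphere X. op_norm X S = 1 \<and> norm (S x0) = 1 \<and>
         op_norm X (\<lambda>z. S z - T z) < e \<and> vnorm X (vdiff X x x0) < e"
    by blast
  \<comment> \<open>The bound 1/2 makes the operator built from \<open>y0\<close> and \<open>y1\<close> nonzero, so that it can be normalised.\<close>
  define \<delta> where "\<delta> = min \<eta> 1 / 2"
  have \<delta>: "\<delta> > 0" "\<delta> < \<eta>" "\<delta> \<le> 1 / 2" using \<eta> by (auto simp: \<delta>_def)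
  let ?A = "indicator A :: 'a \<Rightarrow> complex" and ?B = "indicator B :: 'a \<Rightarrow> complex"
  have ess: "f \<in> ess_bdd M" if "f \<in> V" for f using that V_ess_bdd by blast
  have AB1: "AE t in M. cmod (?A t) \<le> 1" "AE t in M. cmod (?B t) \<le> 1"
    by (auto simp: indicator_def)
  have "norm y0 < 1 - \<delta>"
    if circle: "\<And>w. cmod w = 1 \<Longrightarrow> norm (y0 + w *\<^sub>C y1) \<le> 1" and y1: "norm y1 > \<epsilon>"
    for y0 y1 :: 'b
  proof (rule ccontr)
    assume "\<not> norm y0 < 1 - \<delta>"
    then have y0: "norm y0 \<ge> 1 - \<delta>" by simp
    obtain \<phi> :: "('a \<Rightarrow> complex) \<Rightarrow> complex" where
      "\<forall>f\<in>ess_bdd M. \<forall>g\<in>ess_bdd M. \<phi> (\<lambda>t. f t + g t) = \<phi> f + \<phi> g"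
      "\<forall>a. \<forall>f\<in>ess_bdd M. \<phi> (\<lambda>t. a * f t) = a * \<phi> f"
      "\<forall>f\<in>ess_bdd M. \<forall>C. (AE t in M. cmod (f t) \<le> C) \<longrightarrow> cmod (\<phi> f) \<le> C"
      "\<forall>f c. (\<forall>t. t \<in> A \<longrightarrow> f t = c) \<longrightarrow> \<phi> f = c"
      using functional_concentrated_on[where M = M and P = "\<lambda>t. t \<in> A", OF A(3)] .
    note \<phi> = this[rule_format]
    obtain \<psi> :: "('a \<Rightarrow> complex) \<Rightarrow> complex" where
      "\<forall>f\<in>ess_bdd M. \<forall>g\<in>ess_bdd M. \<psi> (\<lambda>t. f t + g t) = \<psi> f + \<psi> g"
      "\<forall>a. \<forall>f\<in>ess_bdd M. \<psi> (\<lambda>t. a * f t) = a * \<psi> f"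
      "\<forall>f\<in>ess_bdd M. \<forall>C. (AE t in M. cmod (f t) \<le> C) \<longrightarrow> cmod (\<psi> f) \<le> C"
      "\<forall>f c. (\<forall>t. t \<in> B \<longrightarrow> f t = c) \<longrightarrow> \<psi> f = c"
      using functional_concentrated_on[where M = M and P = "\<lambda>t. t \<in> B", OF B(3)] .
    note \<psi> = this[rule_format]
    have on_AB: "\<phi> ?A = 1" "\<phi> ?B = 0" "\<psi> ?A = 0" "\<psi> ?B = 1"
      using disjoint by (auto intro!: \<phi>(4) \<psi>(4) simp: indicator_def)
    define R where "R f = \<phi> f *\<^sub>C y0 + \<psi> f *\<^sub>C y1" for f
    have R: "R \<in> ops_bounded_by M 1"
    proof (rule ops_bounded_byI)
      fix f assume f: "f \<in> ess_bdd M" "AE t in M. cmod (f t) \<le> 1"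
      show "norm (R f) \<le> 1"
        unfolding R_def by (intro norm_combination_le circle \<phi>(3) \<psi>(3) f)
    qed (simp_all add: R_def \<phi> \<psi> scaleC_add_left scaleC_add_right scaleC_scaleC)
    have R_AB: "R ?A = y0" "R ?B = y1" by (simp_all add: R_def on_AB scaleC_one)
    define K where "K = op_norm X (\<lambda>z. R (rep z))"
    have RX: "(\<lambda>z. R (rep z)) \<in> bounded_ops X" and Rq: "\<And>f. f \<in> V \<Longrightarrow> R (rep (q f)) = R f"
      by (fact bounded_ops_rep[OF R])+
    have R_le_K: "norm (R f) \<le> K" if "f \<in> V" "AE t in M. cmod (f t) \<le> 1" for f
      using norm_le_op_norm[OF RX that] Rq that unfolding K_def by simp
    have "K \<le> 1"
      unfolding K_def
    proof (rule op_norm_le)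
      fix f assume f: "f \<in> V" "AE t in M. cmod (f t) \<le> 1"
      then show "norm (R (rep (q f))) \<le> 1" using ops_bound[OF R ess _ f(2)] Rq by simp
    qed
    have "K \<ge> norm y0" using R_le_K[OF A(2) AB1(1)] R_AB by simp
    then have K: "K > 0" using y0 \<delta> by linarith
    define T\<^sub>0 where "T\<^sub>0 f = of_real (1 / K) *\<^sub>C R f" for f
    have T\<^sub>0: "T\<^sub>0 \<in> ops_bounded_by M (1 / K)"
      using ops_scaleC[OF R, of "of_real (1 / K)"] K unfolding T\<^sub>0_def[abs_def] by (simp add: norm_divide)
    define T where "T z = T\<^sub>0 (rep z)" for z
    have T: "T \<in> bounded_ops X" and Tq: "\<And>f. f \<in> V \<Longrightarrow> T (q f) = T\<^sub>0 f"
      unfolding T_def[abs_def] by (fact bounded_ops_rep[OF T\<^sub>0])+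
    have norm_T\<^sub>0: "norm (T\<^sub>0 f) = norm (R f) / K" for f
      using K by (simp add: T\<^sub>0_def norm_scaleC norm_divide)
    have T1: "op_norm X T = 1"
    proof (rule antisym)
      show "op_norm X T \<le> 1"
        by (rule op_norm_le) (use R_le_K K in \<open>simp add: Tq norm_T\<^sub>0\<close>)
      have "op_norm X (\<lambda>z. R (rep z)) \<le> K * op_norm X T"
      proof (rule op_norm_le)
        fix f assume f: "f \<in> V" "AE t in M. cmod (f t) \<le> 1"
        then show "norm (R (rep (q f))) \<le> K * op_norm X T"
          using norm_le_op_norm[OF T f] K by (simp add: Tq norm_T\<^sub>0 Rq field_simps)
      qed
      then have "K \<le> K * op_norm X T" unfolding K_def[symmetric] .
      then show "1 \<le> op_norm X T" using K by simp
    qed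
    have "q ?A \<in> unit_sphere X"
    proof -
      have "vnorm X (q ?A) \<le> 1" using vnorm_q[OF A(2)] AB1(1) by simp
      moreover have "\<not> vnorm X (q ?A) < 1"
      proof
        assume less: "vnorm X (q ?A) < 1"
        have "AE t in M. t \<notin> A"
          using AE_le_vnorm[OF A(2)] by eventually_elim (use less in \<open>auto simp: indicator_def split: if_splits\<close>)
        then show False using A(3) by simp
      qed
      ultimately show ?thesis unfolding unit_sphere_def using q_vecs[OF A(2)] by simp
    qed
    moreover have "norm (T (q ?A)) > 1 - \<eta>"
    proof -
      have "norm y0 * K \<le> norm y0 * 1" using \<open>K \<le> 1\<close> by (intro mult_left_mono) auto
      then have "norm y0 \<le> norm y0 / K" using K by (simp add: field_simps)
      then show ?thesis using y0 \<delta> by (simp add: Tq[OF A(2)] norm_T\<^sub>0 R_AB)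
    qed
    ultimately obtain S z where S: "S \<in> RSE X" "op_norm X S = 1" and z: "z \<in> unit_sphere X"
      "norm (S z) = 1" and ST: "op_norm X (\<lambda>z. S z - T z) < e" and near: "vnorm X (vdiff X (q ?A) z) < e"
      using approx[OF T _ T1] by blast
    have S_ops: "S \<in> bounded_ops X" using S(1) unfolding RSE_def by blast
    obtain x1 where x1: "\<And>x. (\<And>n :: nat. x n \<in> unit_ball X) \<Longrightarrow>
        (\<lambda>n. norm (S (x n))) \<longlonglongrightarrow> op_norm X S \<Longrightarrow>
        \<exists>\<sigma> :: nat \<Rightarrow> nat. \<exists>\<theta>. strict_mono \<sigma> \<and> cmod \<theta> = 1 \<and> (\<lambda>n. S (x (\<sigma> n))) \<longlonglongrightarrow> \<theta> *\<^sub>C S x1"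
      using S(1) unfolding RSE_def by blast
    have attaining: "\<exists>\<theta>. cmod \<theta> = 1 \<and> S (q f) = \<theta> *\<^sub>C S x1"
      if f: "f \<in> V" "AE t in M. cmod (f t) \<le> 1" "norm (S (q f)) = 1" for f
    proof -
      obtain \<theta> where \<theta>: "cmod \<theta> = 1" "(\<lambda>n :: nat. S (q f)) \<longlonglongrightarrow> \<theta> *\<^sub>C S x1"
        using x1[of "\<lambda>_. q f"] unit_ball_q[OF f(1)] f(2,3) S(2) by auto
      then show ?thesis using LIMSEQ_const_iff[of "S (q f)"] by blast
    qed
    define g where "g = rep z"
    have gV: "g \<in> V" "q g = z" using rep z unfolding g_def unit_sphere_def by auto
    have g1: "AE t in M. cmod (g t) \<le> 1"
      using vnorm_q[OF gV(1), of 1] gV(2) z unfolding unit_sphere_def by simp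
    have "vnorm X (q (\<lambda>t. ?A t - g t)) \<le> 1 / 2"
      using near e(3) vdiff_q[OF A(2) gV(1)] gV(2) by simp
    then have close: "AE t in M. cmod (?A t - g t) \<le> 1 / 2"
      using vnorm_q[OF V_diff[OF A(2) gV(1)], of "1 / 2"] by simp
    \<comment> \<open>As \<open>g\<close> is small on \<open>B\<close>, moving it there by 1/2 in either direction stays in the unit ball.\<close>
    define h where "h t = (1 / 2) * ?B t" for t
    have hV: "h \<in> V" unfolding h_def using V_scale[OF B(2)] .
    have gh: "AE t in M. cmod (g t + h t) \<le> 1 \<and> cmod (g t - h t) \<le> 1"
      using close g1
    proof eventually_elim
      case (elim t)
      show ?case
      proof (cases "t \<in> B")
        case True
        then have "t \<notin> A" using disjoint by blast
        then have "cmod (g t) \<le> 1 / 2" using elim(1) by simp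
        moreover have "cmod (h t) = 1 / 2" using True by (simp add: h_def norm_divide)
        ultimately show ?thesis
          using norm_triangle_ineq[of "g t" "h t"] norm_triangle_ineq4[of "g t" "h t"] by linarith
      qed (use elim in \<open>simp add: h_def\<close>)
    qed
    define p where "p = S (q g)"
    define d where "d = S (q h)"
    have p: "norm p = 1" using z(2) gV(2) by (simp add: p_def)
    have plus: "S (q (\<lambda>t. g t + h t)) = p + d"
      unfolding p_def d_def by (rule bounded_ops_add[OF S_ops gV(1) hV])
    have minus: "S (q (\<lambda>t. g t - h t)) = p - d"
      unfolding p_def d_def by (rule bounded_ops_diff[OF S_ops gV(1) hV])
    have gh1: "AE t in M. cmod (g t + h t) \<le> 1" "AE t in M. cmod (g t - h t) \<le> 1"
      using gh by auto
    have le: "norm (p + d) \<le> 1" "norm (p - d) \<le> 1"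
      using norm_le_op_norm[OF S_ops V_add[OF gV(1) hV] gh1(1)]
        norm_le_op_norm[OF S_ops V_diff[OF gV(1) hV] gh1(2)] S(2) by (simp_all add: plus minus)
    have "2 = norm (2 *\<^sub>R p)" using p by simp
    also have "2 *\<^sub>R p = (p + d) + (p - d)" by (simp add: scaleR_2)
    also have "norm \<dots> \<le> norm (p + d) + norm (p - d)" by (rule norm_triangle_ineq)
    finally have norms: "norm (p + d) = 1" "norm (p - d) = 1" using le by simp_all
    obtain c0 where c0: "cmod c0 = 1" "p = c0 *\<^sub>C S x1"
      using attaining[OF gV(1) g1] p unfolding p_def by blast
    obtain c1 where c1: "cmod c1 = 1" "p + d = c1 *\<^sub>C S x1"
      using attaining[OF V_add[OF gV(1) hV] gh1(1)] norms(1) unfolding plus by blast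
    obtain c2 where c2: "cmod c2 = 1" "p - d = c2 *\<^sub>C S x1"
      using attaining[OF V_diff[OF gV(1) hV] gh1(2)] norms(2) unfolding minus by blast
    have "S x1 \<noteq> 0" using c0(2) p by auto
    then have "d = 0" by (rule segment_in_rotations_trivial[OF c0(2) c1(2) c2(2) c0(1) c1(1) c2(1)])
    moreover have "d = (1 / 2) *\<^sub>C S (q ?B)"
      unfolding d_def h_def[abs_def] by (rule bounded_ops_scale[OF S_ops B(2)])
    ultimately have "S (q ?B) = 0" by simp
    then have "norm (T (q ?B)) \<le> op_norm X (\<lambda>z. S z - T z)"
      using norm_le_op_norm[OF bounded_ops_minus[OF S_ops T] B(2) AB1(2)] by simp
    then have "norm y1 / K < e" using ST by (simp add: Tq[OF B(2)] norm_T\<^sub>0 R_AB)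
    moreover have "norm y1 * K \<le> norm y1 * 1" using \<open>K \<le> 1\<close> by (intro mult_left_mono) auto
    then have "norm y1 \<le> norm y1 / K" using K by (simp add: field_simps)
    ultimately show False using y1 e(2) by linarith
  qed
  then show "\<exists>\<delta>>0. \<forall>y0 y1 :: 'b.
      (\<forall>w. cmod w = 1 \<longrightarrow> norm (y0 + w *\<^sub>C y1) \<le> 1) \<and> \<epsilon> < norm y1 \<longrightarrow> norm y0 < 1 - \<delta>"
    using \<delta>(1) by blast
qed

lemma (in function_model) BPBp_RSE_iff_convex:
  assumes "A \<in> sets M" "indicator A \<in> V" "\<not> (AE t in M. t \<notin> A)"
    and "B \<in> sets M" "indicator B \<in> V" "\<not> (AE t in M. t \<notin> B)"
    and "A \<inter> B = {}"
  shows "BPBp_RSE X TYPE('b::complex_banach) \<longleftrightarrow> C_uniformly_convex TYPE('b)"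
  using BPBp_RSE_imp_convex[OF assms] convex_imp_BPBp_RSE by blast

section \<open>The four spaces\<close>

lemma sup_seq_space_model:
  assumes bd: "\<And>x. x \<in> V \<Longrightarrow> bounded (range x)"
    and zero: "(\<lambda>_. 0) \<in> V" and add: "\<And>x y. x \<in> V \<Longrightarrow> y \<in> V \<Longrightarrow> (\<lambda>i. x i + y i) \<in> V"
    and ideal: "\<And>x y C. x \<in> V \<Longrightarrow> (\<And>i. cmod (y i) \<le> C * cmod (x i)) \<Longrightarrow> y \<in> V"
  shows "function_model (count_space UNIV) V (\<lambda>x. x) (sup_seq_space V)"
proof
  have bdd: "bdd_above (range (\<lambda>i. cmod (x i)))" if "x \<in> V" for x
  proof (rule bounded_imp_bdd_above)
    show "bounded (range (\<lambda>i. cmod (x i)))" using bd[OF that] by (simp add: bounded_norm_comp)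
  qed
  show "V \<subseteq> ess_bdd (count_space UNIV)"
  proof
    fix x assume "x \<in> V"
    then obtain C where "\<And>i. cmod (x i) \<le> C" using bd unfolding bounded_iff by blast
    then show "x \<in> ess_bdd (count_space UNIV)"
      by (intro ess_bddI[where C = C]) (simp_all add: AE_count_space)
  qed
  show "vnorm (sup_seq_space V) x \<le> C \<longleftrightarrow> (AE i in count_space UNIV. cmod (x i) \<le> C)"
    if "x \<in> V" for x C
    using cSUP_le_iff[OF _ bdd[OF that]] by (simp add: sup_seq_space_def AE_count_space)
  show "0 \<le> vnorm (sup_seq_space V) x" if "x \<in> V" for x
    using cSUP_upper2[OF bdd[OF that], of 0 0] by (simp add: sup_seq_space_def)
  show "y \<in> V" if "x \<in> V" "AE i in count_space UNIV. cmod (y i) \<le> C * cmod (x i)" for x y C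
  proof (rule ideal[OF that(1)])
    show "cmod (y i) \<le> C * cmod (x i)" for i using that(2) by (simp add: AE_count_space)
  qed
qed (simp_all add: sup_seq_space_def zero add)

lemma BPBp_RSE_sup_seq_space_iff:
  assumes "\<And>x. x \<in> V \<Longrightarrow> bounded (range x)"
    and "(\<lambda>_. 0) \<in> V" "\<And>x y. x \<in> V \<Longrightarrow> y \<in> V \<Longrightarrow> (\<lambda>i. x i + y i) \<in> V"
    and "\<And>x y C. x \<in> V \<Longrightarrow> (\<And>i. cmod (y i) \<le> C * cmod (x i)) \<Longrightarrow> y \<in> V"
    and unit: "indicator {0} \<in> V" "indicator {1} \<in> V"
  shows "BPBp_RSE (sup_seq_space V) TYPE('b::complex_banach) \<longleftrightarrow> C_uniformly_convex TYPE('b)"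
proof -
  interpret function_model "count_space UNIV" V "\<lambda>x. x" "sup_seq_space V"
    by (rule sup_seq_space_model) (fact assms)+
  show ?thesis
    by (rule BPBp_RSE_iff_convex[OF _ unit(1) _ _ unit(2)]) (auto simp: AE_count_space)
qed

lemma bounded_range_bound: "bounded (range (x :: nat \<Rightarrow> complex)) \<longleftrightarrow> (\<exists>C. \<forall>i. cmod (x i) \<le> C)"
  unfolding bounded_iff by auto

lemma BPBp_RSE_l_inf_iff: "BPBp_RSE l_inf TYPE('b::complex_banach) \<longleftrightarrow> C_uniformly_convex TYPE('b)"
  unfolding l_inf_def
proof (rule BPBp_RSE_sup_seq_space_iff)
  show "(\<lambda>i. x i + y i) \<in> {x. bounded (range x)}"
    if "x \<in> {x. bounded (range x)}" "y \<in> {x. bounded (range x)}" for x y :: "nat \<Rightarrow> complex"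
    using that bounded_plus_comp[of x UNIV y] by simp
  show "y \<in> {x. bounded (range x)}"
    if x: "x \<in> {x. bounded (range x)}" and y: "\<And>i. cmod (y i) \<le> C * cmod (x i)"
    for x y :: "nat \<Rightarrow> complex" and C
  proof -
    obtain D where D: "\<And>i. cmod (x i) \<le> D" using x by (auto simp: bounded_range_bound)
    have "cmod (y i) \<le> \<bar>C\<bar> * D" for i
    proof -
      have "C * cmod (x i) \<le> \<bar>C\<bar> * D" using D[of i] by (intro mult_mono) auto
      then show ?thesis using y[of i] by simp
    qed
    then show ?thesis by (auto simp: bounded_range_bound)
  qed
  show "indicator {0} \<in> {x :: nat \<Rightarrow> complex. bounded (range x)}"
    "indicator {1} \<in> {x :: nat \<Rightarrow> complex. bounded (range x)}"
    by (auto simp: bounded_range_bound indicator_def intro!: exI[of _ 1])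
qed auto

lemma BPBp_RSE_c_zero_iff: "BPBp_RSE c_zero TYPE('b::complex_banach) \<longleftrightarrow> C_uniformly_convex TYPE('b)"
  unfolding c_zero_def
proof (rule BPBp_RSE_sup_seq_space_iff)
  show "bounded (range x)" if "x \<in> {x. x \<longlonglongrightarrow> 0}" for x :: "nat \<Rightarrow> complex"
    using that convergent_imp_bounded by auto
  show "(\<lambda>i. x i + y i) \<in> {x. x \<longlonglongrightarrow> 0}"
    if "x \<in> {x. x \<longlonglongrightarrow> 0}" "y \<in> {x. x \<longlonglongrightarrow> 0}" for x y :: "nat \<Rightarrow> complex"
    using that tendsto_add[of x 0 sequentially y 0] by simp
  show "y \<in> {x. x \<longlonglongrightarrow> 0}"
    if "x \<in> {x. x \<longlonglongrightarrow> 0}" "\<And>i. cmod (y i) \<le> C * cmod (x i)" for x y :: "nat \<Rightarrow> complex" and C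
  proof -
    have "(\<lambda>i. C * cmod (x i)) \<longlonglongrightarrow> 0"
      using that(1) by (intro tendsto_mult_right_zero tendsto_norm_zero) simp
    then have "y \<longlonglongrightarrow> 0" by (rule Lim_null_comparison[rotated]) (simp add: that(2))
    then show ?thesis by simp
  qed
  show "indicator {0} \<in> {x :: nat \<Rightarrow> complex. x \<longlonglongrightarrow> 0}"
    "indicator {1} \<in> {x :: nat \<Rightarrow> complex. x \<longlonglongrightarrow> 0}"
    by (auto intro!: tendsto_eventually eventually_sequentiallyI[of 2] simp: indicator_def)
qed auto

lemma BPBp_RSE_l_inf_fin_iff:
  assumes "m \<ge> 2"
  shows "BPBp_RSE (l_inf_fin m) TYPE('b::complex_banach) \<longleftrightarrow> C_uniformly_convex TYPE('b)"
  unfolding l_inf_fin_def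
proof (rule BPBp_RSE_sup_seq_space_iff)
  show "bounded (range x)" if "x \<in> {x. \<forall>i\<ge>m. x i = 0}" for x :: "nat \<Rightarrow> complex"
  proof -
    have "range x \<subseteq> insert 0 (x ` {..<m})"
    proof
      fix z assume "z \<in> range x"
      then obtain i where "z = x i" by blast
      then show "z \<in> insert 0 (x ` {..<m})" using that by (cases "i < m") auto
    qed
    then have "finite (range x)" by (rule finite_subset) simp
    then show ?thesis by (rule finite_imp_bounded)
  qed
  show "y \<in> {x. \<forall>i\<ge>m. x i = 0}"
    if "x \<in> {x. \<forall>i\<ge>m. x i = 0}" "\<And>i. cmod (y i) \<le> C * cmod (x i)" for x y :: "nat \<Rightarrow> complex" and C
  proof (intro CollectI allI impI)
    fix i assume "i \<ge> m"
    then have "x i = 0" using that(1) by simp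
    then show "y i = 0" using that(2)[of i] by simp
  qed
qed (use assms in \<open>auto simp: indicator_def\<close>)

lemma ae_rel_equiv: "equiv (ess_bdd M) (ae_rel M)"
proof (rule equivI)
  show "refl_on (ess_bdd M) (ae_rel M)" by (auto simp: refl_on_def ae_rel_def)
  show "sym (ae_rel M)"
  proof (rule symI)
    fix f g assume "(f, g) \<in> ae_rel M"
    then show "(g, f) \<in> ae_rel M" by (auto simp: ae_rel_def elim: eventually_mono)
  qed
  show "trans (ae_rel M)"
  proof (rule transI)
    fix f g h assume "(f, g) \<in> ae_rel M" "(g, h) \<in> ae_rel M"
    moreover have "AE t in M. f t = h t" if "AE t in M. f t = g t" "AE t in M. g t = h t"
      using that by eventually_elim simp
    ultimately show "(f, h) \<in> ae_rel M" by (auto simp: ae_rel_def)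
  qed
qed (auto simp: ae_rel_def)

lemma esssup_le_iff:
  assumes f: "f \<in> ess_bdd M" and C: "0 \<le> C"
  shows "real_of_ereal (esssup M (\<lambda>t. ereal (cmod (f t)))) \<le> C \<longleftrightarrow> (AE t in M. cmod (f t) \<le> C)"
proof -
  let ?s = "esssup M (\<lambda>t. ereal (cmod (f t)))"
  note [measurable] = ess_bdd_measurable[OF f]
  have meas: "(\<lambda>t. ereal (cmod (f t))) \<in> borel_measurable M" by measurable
  obtain D where D: "D > 0" "AE t in M. cmod (f t) \<le> D" using ess_bdd_bound[OF f] .
  have "?s \<le> ereal D" using D(2) by (intro esssup_I[OF meas]) simp
  then have fin: "?s \<noteq> \<infinity>" by auto
  show ?thesis
  proof
    assume "real_of_ereal ?s \<le> C"
    then have "?s \<le> ereal C" using fin C by (cases ?s) auto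
    moreover have "AE t in M. ereal (cmod (f t)) \<le> ?s" by (rule esssup_AE)
    ultimately have "AE t in M. ereal (cmod (f t)) \<le> ereal C"
      by (metis (mono_tags, lifting) eventually_mono order_trans)
    then show "AE t in M. cmod (f t) \<le> C" by simp
  next
    assume "AE t in M. cmod (f t) \<le> C"
    then have "?s \<le> ereal C" by (intro esssup_I[OF meas]) simp
    then show "real_of_ereal ?s \<le> C" using fin C by (cases ?s) auto
  qed
qed

lemma L_inf_model: "function_model M (ess_bdd M) (\<lambda>f. ae_rel M `` {f}) (L_inf M)"
proof
  note equiv = ae_rel_equiv[of M]
  have class_eq: "ae_rel M `` {f} = ae_rel M `` {g}"
    if "f \<in> ess_bdd M" "g \<in> ess_bdd M" "AE t in M. f t = g t" for f g
    using that equiv by (intro equiv_class_eq[OF equiv]) (simp add: ae_rel_def)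
  have mem: "g \<in> ess_bdd M \<and> (AE t in M. g t = f t)" if "g \<in> ae_rel M `` {f}" for f g
    using that by (auto simp: ae_rel_def elim: eventually_mono)
  have self: "f \<in> ae_rel M `` {f}" if "f \<in> ess_bdd M" for f
    using that by (simp add: ae_rel_def)
  show "vecs (L_inf M) = (\<lambda>f. ae_rel M `` {f}) ` ess_bdd M"
    by (auto simp: L_inf_def quotient_def)
  show "vadd (L_inf M) (ae_rel M `` {f}) (ae_rel M `` {g}) = ae_rel M `` {\<lambda>t. f t + g t}"
    if fg: "f \<in> ess_bdd M" "g \<in> ess_bdd M" for f g
  proof -
    have const: "ae_rel M `` {\<lambda>t. f' t + g' t} = ae_rel M `` {\<lambda>t. f t + g t}"
      if "f' \<in> ae_rel M `` {f}" "g' \<in> ae_rel M `` {g}" for f' g'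
    proof -
      have f': "f' \<in> ess_bdd M" "AE t in M. f' t = f t" using mem[OF that(1)] by auto
      have g': "g' \<in> ess_bdd M" "AE t in M. g' t = g t" using mem[OF that(2)] by auto
      have "AE t in M. f' t + g' t = f t + g t" using f'(2) g'(2) by eventually_elim simp
      then show ?thesis by (intro class_eq ess_bdd_add f' g' fg)
    qed
    have "ae_rel M `` {f} \<noteq> {}" "ae_rel M `` {g} \<noteq> {}" using self fg by blast+
    moreover have "(\<Union>f'\<in>ae_rel M `` {f}. \<Union>g'\<in>ae_rel M `` {g}. ae_rel M `` {\<lambda>t. f' t + g' t}) =
        (\<Union>f'\<in>ae_rel M `` {f}. \<Union>g'\<in>ae_rel M `` {g}. ae_rel M `` {\<lambda>t. f t + g t})"
      by (intro SUP_cong refl const)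
    ultimately show ?thesis by (simp add: L_inf_def)
  qed
  show "vscale (L_inf M) a (ae_rel M `` {f}) = ae_rel M `` {\<lambda>t. a * f t}"
    if f: "f \<in> ess_bdd M" for a f
  proof -
    have const: "ae_rel M `` {\<lambda>t. a * f' t} = ae_rel M `` {\<lambda>t. a * f t}" if "f' \<in> ae_rel M `` {f}" for f'
    proof -
      have f': "f' \<in> ess_bdd M" "AE t in M. f' t = f t" using mem[OF that] by auto
      have "AE t in M. a * f' t = a * f t" using f'(2) by eventually_elim simp
      then show ?thesis by (intro class_eq ess_bdd_scale f' f)
    qed
    have "ae_rel M `` {f} \<noteq> {}" using self f by blast
    moreover have "(\<Union>f'\<in>ae_rel M `` {f}. ae_rel M `` {\<lambda>t. a * f' t}) =
        (\<Union>f'\<in>ae_rel M `` {f}. ae_rel M `` {\<lambda>t. a * f t})"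
      by (intro SUP_cong refl const)
    ultimately show ?thesis by (simp add: L_inf_def)
  qed
  have vnorm: "vnorm (L_inf M) (ae_rel M `` {f}) = real_of_ereal (esssup M (\<lambda>t. ereal (cmod (f t))))"
    if f: "f \<in> ess_bdd M" for f
  proof -
    let ?n = "\<lambda>f. real_of_ereal (esssup M (\<lambda>t. ereal (cmod (f t))))"
    have "?n f' = ?n f" if "f' \<in> ae_rel M `` {f}" for f'
    proof -
      have f': "f' \<in> ess_bdd M" "AE t in M. f' t = f t" using mem[OF that] by auto
      note [measurable] = ess_bdd_measurable[OF f] ess_bdd_measurable[OF f'(1)]
      have "AE t in M. ereal (cmod (f' t)) = ereal (cmod (f t))"
        using f'(2) by eventually_elim simp
      then have "esssup M (\<lambda>t. ereal (cmod (f' t))) = esssup M (\<lambda>t. ereal (cmod (f t)))"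
        by (intro esssup_AE_cong) measurable
      then show ?thesis by simp
    qed
    then have "?n ` (ae_rel M `` {f}) = {?n f}" using self[OF f] by blast
    then show ?thesis unfolding L_inf_def by simp
  qed
  show "vnorm (L_inf M) (ae_rel M `` {f}) \<le> C \<longleftrightarrow> (AE t in M. cmod (f t) \<le> C)"
    if "f \<in> ess_bdd M" "0 \<le> C" for f C
    using vnorm esssup_le_iff that by simp
  show "0 \<le> vnorm (L_inf M) (ae_rel M `` {f})" if "f \<in> ess_bdd M" for f
  proof (cases "emeasure M (space M) = 0")
    case True
    note [measurable] = ess_bdd_measurable[OF that]
    have "esssup M (\<lambda>t. ereal (cmod (f t))) = - \<infinity>" using True by (rule esssup_zero_space) measurable
    then show ?thesis using vnorm[OF that] by simp
  next
    case False
    note [measurable] = ess_bdd_measurable[OF that]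
    have "0 = esssup M (\<lambda>t. 0 :: ereal)" by (rule esssup_const[OF False, symmetric])
    also have "\<dots> \<le> esssup M (\<lambda>t. ereal (cmod (f t)))" by (intro esssup_mono) auto
    finally show ?thesis using vnorm[OF that] by (simp add: real_of_ereal_pos)
  qed
  show "g \<in> ess_bdd M"
    if f: "f \<in> ess_bdd M" and g: "g \<in> borel_measurable M" "AE t in M. cmod (g t) \<le> C * cmod (f t)"
    for f g C
  proof -
    obtain D where D: "D > 0" "AE t in M. cmod (f t) \<le> D" using ess_bdd_bound[OF f] .
    have "AE t in M. cmod (g t) \<le> \<bar>C\<bar> * D"
      using g(2) D(2)
    proof eventually_elim
      case (elim t)
      have "C * cmod (f t) \<le> \<bar>C\<bar> * D" using elim by (intro mult_mono) auto
      then show ?case using elim by simp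
    qed
    then show ?thesis by (rule ess_bddI[OF g(1)])
  qed
qed (auto intro: ess_bdd_add)

text \<open>
  If no measurable set splits the measure, then the almost everywhere filter decides every measurable
  predicate, so that a cluster point of an essentially bounded function along it is its value
  almost everywhere.
\<close>

lemma ess_constant_if_no_splitting:
  assumes split: "\<And>A. A \<in> sets M \<Longrightarrow> (AE t in M. t \<notin> A) \<or> (AE t in M. t \<in> A)"
    and f: "f \<in> ess_bdd M"
  shows "\<exists>c. AE t in M. f t = c"
proof (cases "ae_filter M = bot")
  case True
  have "AE t in M. f t = 0" unfolding True by simp
  then show ?thesis by blast
next
  case False
  note [measurable] = ess_bdd_measurable[OF f]
  obtain C where C: "C > 0" "AE t in M. cmod (f t) \<le> C" using ess_bdd_bound[OF f] .
  have "\<exists>c\<in>cball 0 C. inf (nhds c) (filtermap f (ae_filter M)) \<noteq> bot"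
    using compact_cball[of "0 :: complex" C] C(2) False unfolding compact_filter
    by (auto simp: eventually_filtermap filtermap_bot_iff)
  then obtain c where c: "inf (nhds c) (filtermap f (ae_filter M)) \<noteq> bot" by blast
  have "AE t in M. f t \<in> ball c (1 / Suc n)" for n
  proof (rule ccontr)
    assume not: "\<not> ?thesis"
    define A where "A = {t \<in> space M. f t \<in> ball c (1 / Suc n)}"
    have "A \<in> sets M" unfolding A_def mem_ball by measurable
    moreover have "\<not> (AE t in M. t \<in> A)" using not by (auto simp: A_def elim: eventually_mono)
    ultimately have "AE t in M. t \<notin> A" using split by blast
    then have "AE t in M. f t \<notin> ball c (1 / Suc n)"
      using AE_space by eventually_elim (simp add: A_def)
    then have "eventually (\<lambda>z. z \<notin> ball c (1 / Suc n)) (filtermap f (ae_filter M))"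
      by (simp add: eventually_filtermap)
    moreover have "eventually (\<lambda>z. z \<in> ball c (1 / Suc n)) (nhds c)"
      by (intro eventually_nhds_in_open) auto
    ultimately have "eventually (\<lambda>z. False) (inf (nhds c) (filtermap f (ae_filter M)))"
      unfolding eventually_inf by auto
    then show False using c by (simp add: trivial_limit_def)
  qed
  then have "AE t in M. \<forall>n. f t \<in> ball c (1 / Suc n)" by (simp add: AE_all_countable)
  then have "AE t in M. f t = c"
  proof eventually_elim
    case (elim t)
    have "dist c (f t) \<le> r" if "r > 0" for r
    proof -
      obtain n where "1 / Suc n < r" using \<open>r > 0\<close> nat_approx_posE by metis
      then show ?thesis using elim[rule_format, of n] by simp
    qed
    then have "dist c (f t) \<le> 0" by (rule field_le_epsilon) simp
    then show ?case by simp
  qed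
  then show ?thesis by blast
qed

text \<open>Otherwise all classes are multiples of the class of the constant function 1.\<close>

lemma splitting_set_if_dim_ge_two:
  assumes dim: "dim_ge_two (L_inf M)"
  shows "\<exists>A\<in>sets M. \<not> (AE t in M. t \<notin> A) \<and> \<not> (AE t in M. t \<in> A)"
proof (rule ccontr)
  assume no: "\<not> ?thesis"
  interpret function_model M "ess_bdd M" "\<lambda>f. ae_rel M `` {f}" "L_inf M" by (rule L_inf_model)
  obtain f g where f: "f \<in> ess_bdd M" and g: "g \<in> ess_bdd M"
    and ind: "\<And>a b. vadd (L_inf M) (vscale (L_inf M) a (ae_rel M `` {f}))
        (vscale (L_inf M) b (ae_rel M `` {g})) = vzero (L_inf M) \<Longrightarrow> a = 0 \<and> b = 0"
    using dim unfolding dim_ge_two_def vecs_eq by blast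
  obtain c d where cd: "AE t in M. f t = c" "AE t in M. g t = d"
    using ess_constant_if_no_splitting[OF _ f] ess_constant_if_no_splitting[OF _ g] no by blast
  have independent: "a = 0 \<and> b = 0" if "a * c + b * d = 0" for a b
  proof (rule ind)
    have "AE t in M. a * f t + b * g t = 0" using cd by eventually_elim (use that in simp)
    then have "((\<lambda>t. a * f t + b * g t), (\<lambda>_. 0)) \<in> ae_rel M"
      using f g by (simp add: ae_rel_def ess_bdd_add ess_bdd_scale)
    then have "ae_rel M `` {\<lambda>t. a * f t + b * g t} = ae_rel M `` {\<lambda>_. 0}"
      by (rule equiv_class_eq[OF ae_rel_equiv])
    then show "vadd (L_inf M) (vscale (L_inf M) a (ae_rel M `` {f}))
        (vscale (L_inf M) b (ae_rel M `` {g})) = vzero (L_inf M)"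
      using f g by (simp add: vscale_q vadd_q ess_bdd_scale) (simp add: L_inf_def)
  qed
  have "d = 0" using independent[of d "- c"] by (simp add: mult.commute)
  then show False using independent[of 0 1] by simp
qed

lemma BPBp_RSE_L_inf_iff:
  assumes dim: "dim_ge_two (L_inf M)"
  shows "BPBp_RSE (L_inf M) TYPE('b::complex_banach) \<longleftrightarrow> C_uniformly_convex TYPE('b)"
proof -
  interpret function_model M "ess_bdd M" "\<lambda>f. ae_rel M `` {f}" "L_inf M" by (rule L_inf_model)
  obtain A where A: "A \<in> sets M" "\<not> (AE t in M. t \<notin> A)" "\<not> (AE t in M. t \<in> A)"
    using splitting_set_if_dim_ge_two[OF dim] by blast
  have indicator: "indicator B \<in> ess_bdd M" if "B \<in> sets M" for B
    using that by (intro ess_bddI[where C = 1]) (auto simp: indicator_def)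
  have compl: "\<not> (AE t in M. t \<notin> space M - A)"
  proof
    assume "AE t in M. t \<notin> space M - A"
    then have "AE t in M. t \<in> A" using AE_space by eventually_elim auto
    then show False using A(3) by simp
  qed
  show ?thesis
    by (rule BPBp_RSE_iff_convex[OF A(1) indicator A(2) _ indicator compl]) (use A(1) in auto)
qed

theorem corollary3p6:
  fixes M :: "'a measure" and m :: nat
  assumes dim_Y: "\<exists>B :: 'b::complex_banach set. card B = 2 \<and> complex_vector.independent B"
    and dim_L_inf: "dim_ge_two (L_inf M)"
    and m: "m \<ge> 2"
  shows "(BPBp_RSE (l_inf_fin m) TYPE('b) \<longleftrightarrow> BPBp_RSE c_zero TYPE('b)) \<and>
         (BPBp_RSE c_zero TYPE('b) \<longleftrightarrow> BPBp_RSE l_inf TYPE('b)) \<and>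
         (BPBp_RSE l_inf TYPE('b) \<longleftrightarrow> BPBp_RSE (L_inf M) TYPE('b)) \<and>
         (BPBp_RSE (L_inf M) TYPE('b) \<longleftrightarrow> C_uniformly_convex TYPE('b))"
  by (simp add: BPBp_RSE_l_inf_fin_iff[OF m] BPBp_RSE_c_zero_iff BPBp_RSE_l_inf_iff
      BPBp_RSE_L_inf_iff[OF dim_L_inf])

end
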